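(* Let $n\ge 1$. For any $(\mathbf a_1,\mathbf a_2,\mathbf b_1,\mathbf b_2)\in\mathbb R^{4n}$, with $\mathbf a_1=(a_{i0})_{1\le i\le n}$, $\mathbf a_2=(a_{ii})_{1\le i\le n}$, $\mathbf b_1=(b_{i0})_{1\le i\le n}$, $\mathbf b_2=(b_{ii})_{1\le i\le n}$, there is a real analytic Lorentzian-harmonic map $N=(1+u^2+v^2)^{-1/2}(u,v,1)$ into $\mathbb S^2$, defined on a neighbourhood of the origin of the Lorentz plane $\mathbb R^{1,1}$ with null coordinates $(x,y)$, with $u(0,0)=v(0,0)=0$, whose $n$-jet at the origin is determined by $(\mathbf a_1,\mathbf a_2,\mathbf b_1,\mathbf b_2)$ in the following way: $$j^nu(x,y)=\sum_{k=1}^n a_{k0}x^k+\sum_{k=1}^n a_{kk}y^k+\sum_{k=3}^n\sum_{i=1}^{k-1}P_{ki}(a,b)\,x^{k-i}y^i,$$ $$j^nv(x,y)=\sum_{k=1}^n b_{k0}x^k+\sum_{k=1}^n b_{kk}y^k+\sum_{k=3}^n\sum_{i=1}^{k-1}P_{ki}(b,a)\,x^{k-i}y^i .$$ Here the $P_{ki}$ are the universal polynomials described in the context.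
   Context: A smooth map $N$ from an open subset of a Lorentz surface to $\mathbb S^2\subset\mathbb R^3$ is Lorentzian-harmonic if $N\times N_{xy}=0$ for any null coordinate system $(x,y)$. Writing $N=\delta\,(u,v,1)$ near a point where $N=(0,0,1)$, with $\delta=(1+u^2+v^2)^{-1/2}$ and $u,v$ vanishing at the origin, this is equivalent to the system $$u_{xy}=\frac{2uu_xu_y+v(u_xv_y+u_yv_x)}{1+u^2+v^2},\qquad v_{xy}=\frac{2vv_xv_y+u(u_xv_y+u_yv_x)}{1+u^2+v^2}.$$ Polynomials $P_{ki}$: write $\sum_{k\ge1}\sum_{i=0}^k a_{ki}x^{k-i}y^i$ and $\sum_{k\ge1}\sum_{i=0}^k b_{ki}x^{k-i}y^i$ for the Taylor series of $u$ and $v$. The system forces $a_{21}=b_{21}=0$ and, by successive differentiation at the origin, forces each mixed coefficient $a_{ki}$ ($k\ge3$, $1\le i\le k-1$) to be a universal polynomial $P_{ki}(a,b)$ in $a_{l0},a_{ll},b_{l0},b_{ll}$, $1\le l\le k-2$. By the symmetry $u\leftrightarrow v$ of the system, $b_{ki}=P_{ki}(b,a)$ with the roles of $a$ and $b$ interchanged. For example $P_{31}(a,b)=a_{10}^2a_{11}+\frac12a_{10}b_{10}b_{11}+\frac12a_{11}b_{10}^2$ and $P_{32}(a,b)=a_{10}a_{11}^2+\frac12a_{10}b_{11}^2+\frac12a_{11}b_{10}b_{11}$. *)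

theory Defs
  imports "HOL-Analysis.Analysis"
begin

text \<open>
  Points of the Lorentz plane are represented by their null coordinates, so that the metric is
  the product of the two coordinate differentials (up to the irrelevant normalisation).
\<close>

definition lorentz :: "real \<times> real \<Rightarrow> real \<times> real \<Rightarrow> real" where
  "lorentz v w = fst v * snd w + snd v * fst w"

definition pdx :: "(real \<times> real \<Rightarrow> 'b::real_normed_vector) \<Rightarrow> real \<times> real \<Rightarrow> 'b" where
  "pdx f p = vector_derivative (\<lambda>t. f (t, snd p)) (at (fst p))"

definition pdy :: "(real \<times> real \<Rightarrow> 'b::real_normed_vector) \<Rightarrow> real \<times> real \<Rightarrow> 'b" where
  "pdy f p = vector_derivative (\<lambda>t. f (fst p, t)) (at (snd p))"

primrec Ck_on :: "nat \<Rightarrow> (real \<times> real) set \<Rightarrow> (real \<times> real \<Rightarrow> 'b::real_normed_vector) \<Rightarrow> bool" where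
  "Ck_on 0 U f \<longleftrightarrow> continuous_on U f"
| "Ck_on (Suc k) U f \<longleftrightarrow> f differentiable_on U \<and> Ck_on k U (pdx f) \<and> Ck_on k U (pdy f)"

definition smooth_on :: "(real \<times> real) set \<Rightarrow> (real \<times> real \<Rightarrow> 'b::real_normed_vector) \<Rightarrow> bool" where
  "smooth_on U f \<longleftrightarrow> (\<forall>k. Ck_on k U f)"

definition real_analytic_on ::
    "(real \<times> real) set \<Rightarrow> (real \<times> real \<Rightarrow> 'b::real_normed_vector) \<Rightarrow> bool" where
  "real_analytic_on U f \<longleftrightarrow>
     (\<forall>p\<in>U. \<exists>r>0. \<exists>c :: nat \<Rightarrow> nat \<Rightarrow> 'b. \<forall>x y. \<bar>x\<bar> < r \<longrightarrow> \<bar>y\<bar> < r \<longrightarrow>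
        ((\<lambda>(i, j). (x ^ i * y ^ j) *\<^sub>R c i j) has_sum f (fst p + x, snd p + y)) UNIV)"

text \<open>
  A null coordinate system on an open set \<open>W\<close> of the Lorentz plane, given by the chart
  \<open>\<phi>\<close> from \<open>W\<close> onto \<open>V\<close> and its inverse \<open>\<psi>\<close>; the vectors \<open>pdx \<psi>\<close> and \<open>pdy \<psi>\<close> are the
  coordinate fields of the chart.
\<close>

definition null_coordinates ::
    "(real \<times> real) set \<Rightarrow> (real \<times> real) set \<Rightarrow> (real \<times> real \<Rightarrow> real \<times> real)
      \<Rightarrow> (real \<times> real \<Rightarrow> real \<times> real) \<Rightarrow> bool" where
  "null_coordinates V W \<psi> \<phi> \<longleftrightarrow>
     open V \<and> open W \<and> homeomorphism V W \<psi> \<phi> \<and> smooth_on V \<psi> \<and> smooth_on W \<phi> \<and>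
     (\<forall>q\<in>V. lorentz (pdx \<psi> q) (pdx \<psi> q) = 0 \<and> lorentz (pdy \<psi> q) (pdy \<psi> q) = 0)"

definition lorentzian_harmonic_on :: "(real \<times> real) set \<Rightarrow> (real \<times> real \<Rightarrow> real ^ 3) \<Rightarrow> bool" where
  "lorentzian_harmonic_on U N \<longleftrightarrow>
     open U \<and> smooth_on U N \<and> N ` U \<subseteq> sphere 0 1 \<and>
     (\<forall>V W \<psi> \<phi>. null_coordinates V W \<psi> \<phi> \<longrightarrow> W \<subseteq> U \<longrightarrow>
        (\<forall>q\<in>V. cross3 (N (\<psi> q)) (pdy (pdx (N \<circ> \<psi>)) q) = 0))"

text \<open>Taylor polynomial at the origin.\<close>

definition jet :: "nat \<Rightarrow> (real \<times> real \<Rightarrow> real) \<Rightarrow> real \<Rightarrow> real \<Rightarrow> real" where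
  "jet n f x y =
     (\<Sum>k=0..n. \<Sum>i=0..k. (pdx ^^ (k - i)) ((pdy ^^ i) f) (0, 0) / (fact (k - i) * fact i)
        * x ^ (k - i) * y ^ i)"

text \<open>
  The coefficient of \<open>x\<^sup>p y\<^sup>q\<close> in \<open>u\<close> as forced by the system. For \<open>p, q \<ge> 1\<close>, multiply the first
  equation by \<open>1 + u\<^sup>2 + v\<^sup>2\<close> and compare the coefficients of \<open>x\<^sup>p\<^sup>-\<^sup>1 y\<^sup>q\<^sup>-\<^sup>1\<close> in
  \<open>u\<^sub>x\<^sub>y = 2 u u\<^sub>x u\<^sub>y + v u\<^sub>x v\<^sub>y + v u\<^sub>y v\<^sub>x - (u u + v v) u\<^sub>x\<^sub>y\<close>.
  All terms on the right are trilinear, and the exponents of the three factors (before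
  differentiation) add up to \<open>(p, q)\<close>. Exponent \<open>(0, 0)\<close> may be left out since \<open>u\<close> and \<open>v\<close>
  vanish at the origin. The coefficients of \<open>v\<close> are obtained by exchanging \<open>a\<close> and \<open>b\<close>.
  Only the entries \<open>a l 0\<close>, \<open>a l l\<close>, \<open>b l 0\<close>, \<open>b l l\<close> with \<open>l \<ge> 1\<close> are used.
\<close>

definition splittings :: "nat \<Rightarrow> nat \<Rightarrow> (nat \<times> nat \<times> nat \<times> nat \<times> nat \<times> nat) set" where
  "splittings p q =
     {(i1, j1, i2, j2, i3, j3) | i1 j1 i2 j2 i3 j3.
        i1 + i2 + i3 = p \<and> j1 + j2 + j3 = q \<and>
        (i1, j1) \<noteq> (0, 0) \<and> (i2, j2) \<noteq> (0, 0) \<and> (i3, j3) \<noteq> (0, 0)}"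

lemma splittingsD:
  assumes "(i1, j1, i2, j2, i3, j3) \<in> splittings p q"
  shows "i1 + j1 + 2 \<le> p + q" "i2 + j2 + 2 \<le> p + q" "i3 + j3 + 2 \<le> p + q"
    "i1 \<le> p" "i2 \<le> p" "i3 \<le> p" "j1 \<le> q" "j2 \<le> q" "j3 \<le> q"
proof -
  have *: "i1 + i2 + i3 = p" "j1 + j2 + j3 = q" "i1 + j1 \<noteq> 0" "i2 + j2 \<noteq> 0" "i3 + j3 \<noteq> 0"
    using assms unfolding splittings_def by simp_all
  show "i1 + j1 + 2 \<le> p + q" "i2 + j2 + 2 \<le> p + q" "i3 + j3 + 2 \<le> p + q"
    "i1 \<le> p" "i2 \<le> p" "i3 \<le> p" "j1 \<le> q" "j2 \<le> q" "j3 \<le> q"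
    using * by linarith+
qed

function forced_coef :: "(nat \<Rightarrow> nat \<Rightarrow> real) \<Rightarrow> (nat \<Rightarrow> nat \<Rightarrow> real) \<Rightarrow> nat \<Rightarrow> nat \<Rightarrow> real" where
  "forced_coef a b p q =
     (if p = 0 \<and> q = 0 then 0
      else if q = 0 then a p 0
      else if p = 0 then a q q
      else (\<Sum>(i1, j1, i2, j2, i3, j3)\<in>splittings p q.
              2 * real i2 * real j3 * forced_coef a b i1 j1 * forced_coef a b i2 j2 * forced_coef a b i3 j3
            + real i2 * real j3 * forced_coef b a i1 j1 * forced_coef a b i2 j2 * forced_coef b a i3 j3
            + real j2 * real i3 * forced_coef b a i1 j1 * forced_coef a b i2 j2 * forced_coef b a i3 j3
            - real i3 * real j3 * (forced_coef a b i1 j1 * forced_coef a b i2 j2 + forced_coef b a i1 j1 * forced_coef b a i2 j2)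
                * forced_coef a b i3 j3)
           / (real p * real q))"
  by auto
termination
  by (relation "Wellfounded.measure (\<lambda>(a, b, p, q). p + q)") (auto dest: splittingsD(1-3))

declare forced_coef.simps [simp del]

definition P_poly :: "nat \<Rightarrow> nat \<Rightarrow> (nat \<Rightarrow> nat \<Rightarrow> real) \<Rightarrow> (nat \<Rightarrow> nat \<Rightarrow> real) \<Rightarrow> real" where
  "P_poly k i a b = forced_coef a b (k - i) i"

lemma finite_splittings: "finite (splittings p q)"
proof (rule finite_subset)
  show "splittings p q \<subseteq> {..p} \<times> {..q} \<times> {..p} \<times> {..q} \<times> {..p} \<times> {..q}"
    by (auto dest: splittingsD(4-9))
qed auto

lemma forced_coef_axes:
  "forced_coef a b 0 0 = 0" "p \<noteq> 0 \<Longrightarrow> forced_coef a b p 0 = a p 0" "q \<noteq> 0 \<Longrightarrow> forced_coef a b 0 q = a q q"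
  by (subst forced_coef.simps; simp)+

lemma sum3_cases:
  fixes i j k :: nat
  shows "i + j + k = Suc 0 \<longleftrightarrow> (i, j, k) \<in> {(1, 0, 0), (0, 1, 0), (0, 0, 1)}"
    and "i + j + k = 2 \<longleftrightarrow>
      (i, j, k) \<in> {(2, 0, 0), (0, 2, 0), (0, 0, 2), (1, 1, 0), (1, 0, 1), (0, 1, 1)}"
  unfolding insert_iff empty_iff prod.inject by presburger+

lemma P_2_1: "P_poly 2 1 a b = 0"
proof -
  have "splittings (Suc 0) (Suc 0) = {}"
    unfolding splittings_def sum3_cases by auto
  then show ?thesis
    by (simp add: P_poly_def forced_coef.simps[of a b "Suc 0" "Suc 0"])
qed

lemma P_3_1:
  "P_poly 3 1 a b = (a 1 0)\<^sup>2 * a 1 1 + 1/2 * a 1 0 * b 1 0 * b 1 1 + 1/2 * a 1 1 * (b 1 0)\<^sup>2"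
proof -
  have "splittings 2 (Suc 0) =
      {(0, 1, 1, 0, 1, 0), (1, 0, 0, 1, 1, 0), (1, 0, 1, 0, 0, 1)}"
    unfolding splittings_def sum3_cases by auto
  then show ?thesis
    by (simp add: P_poly_def forced_coef.simps[of a b 2 "Suc 0"] forced_coef_axes field_simps power2_eq_square)
qed

lemma P_3_2:
  "P_poly 3 2 a b = a 1 0 * (a 1 1)\<^sup>2 + 1/2 * a 1 0 * (b 1 1)\<^sup>2 + 1/2 * a 1 1 * b 1 0 * b 1 1"
proof -
  have "splittings (Suc 0) 2 =
      {(1, 0, 0, 1, 0, 1), (0, 1, 1, 0, 0, 1), (0, 1, 0, 1, 1, 0)}"
    unfolding splittings_def sum3_cases by auto
  then show ?thesis
    by (simp add: P_poly_def forced_coef.simps[of a b "Suc 0" 2] forced_coef_axes field_simps power2_eq_square)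
qed

text \<open>Polynomial functions in \<open>a l 0\<close>, \<open>a l l\<close>, \<open>b l 0\<close>, \<open>b l l\<close> for \<open>1 \<le> l \<le> L\<close>.\<close>

inductive_set jet_polys ::
    "nat \<Rightarrow> ((nat \<Rightarrow> nat \<Rightarrow> real) \<Rightarrow> (nat \<Rightarrow> nat \<Rightarrow> real) \<Rightarrow> real) set" for L where
  const: "(\<lambda>a b. c) \<in> jet_polys L"
| a_x: "1 \<le> l \<Longrightarrow> l \<le> L \<Longrightarrow> (\<lambda>a b. a l 0) \<in> jet_polys L"
| a_y: "1 \<le> l \<Longrightarrow> l \<le> L \<Longrightarrow> (\<lambda>a b. a l l) \<in> jet_polys L"
| b_x: "1 \<le> l \<Longrightarrow> l \<le> L \<Longrightarrow> (\<lambda>a b. b l 0) \<in> jet_polys L"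
| b_y: "1 \<le> l \<Longrightarrow> l \<le> L \<Longrightarrow> (\<lambda>a b. b l l) \<in> jet_polys L"
| add: "f \<in> jet_polys L \<Longrightarrow> g \<in> jet_polys L \<Longrightarrow> (\<lambda>a b. f a b + g a b) \<in> jet_polys L"
| mult: "f \<in> jet_polys L \<Longrightarrow> g \<in> jet_polys L \<Longrightarrow> (\<lambda>a b. f a b * g a b) \<in> jet_polys L"

lemma jet_polys_swap: "f \<in> jet_polys L \<Longrightarrow> (\<lambda>a b. f b a) \<in> jet_polys L"
  by (induction rule: jet_polys.induct) (auto intro: jet_polys.intros)

lemma jet_polys_diff:
  assumes "f \<in> jet_polys L" "g \<in> jet_polys L"
  shows "(\<lambda>a b. f a b - g a b) \<in> jet_polys L"
  using jet_polys.add[OF assms(1) jet_polys.mult[OF jet_polys.const[of "-1"] assms(2)]] by simp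

lemma jet_polys_sum:
  "finite S \<Longrightarrow> (\<And>s. s \<in> S \<Longrightarrow> f s \<in> jet_polys L) \<Longrightarrow> (\<lambda>a b. \<Sum>s\<in>S. f s a b) \<in> jet_polys L"
  by (induction S rule: finite_induct) (auto intro: jet_polys.intros)

lemma forced_coef_jet_polys:
  "L \<ge> 1 \<Longrightarrow> p + q \<le> L + (if p = 0 \<or> q = 0 then 0 else 2) \<Longrightarrow> (\<lambda>a b. forced_coef a b p q) \<in> jet_polys L"
proof (induction "p + q" arbitrary: p q rule: less_induct)
  case less
  show ?case
  proof (cases "p = 0 \<or> q = 0")
    case True
    then show ?thesis
      using less.prems by (cases "p = 0"; cases "q = 0") (auto simp: forced_coef_axes intro: jet_polys.intros)
  next
    case False
    have IH: "(\<lambda>a b. forced_coef a b i j) \<in> jet_polys L" "(\<lambda>a b. forced_coef b a i j) \<in> jet_polys L"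
      if "i + j + 2 \<le> p + q" for i j
    proof -
      show "(\<lambda>a b. forced_coef a b i j) \<in> jet_polys L"
        using that less.prems False by (intro less.hyps) auto
      from jet_polys_swap[OF this] show "(\<lambda>a b. forced_coef b a i j) \<in> jet_polys L" .
    qed
    have eq: "(\<lambda>a b. forced_coef a b p q) = (\<lambda>a b. (1 / (real p * real q)) * (\<Sum>s\<in>splittings p q.
        (case s of (i1, j1, i2, j2, i3, j3) \<Rightarrow> \<lambda>a b.
              2 * real i2 * real j3 * forced_coef a b i1 j1 * forced_coef a b i2 j2 * forced_coef a b i3 j3
            + real i2 * real j3 * forced_coef b a i1 j1 * forced_coef a b i2 j2 * forced_coef b a i3 j3
            + real j2 * real i3 * forced_coef b a i1 j1 * forced_coef a b i2 j2 * forced_coef b a i3 j3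
            - real i3 * real j3 * (forced_coef a b i1 j1 * forced_coef a b i2 j2 + forced_coef b a i1 j1 * forced_coef b a i2 j2)
                * forced_coef a b i3 j3) a b))"
      using False by (intro ext, subst forced_coef.simps) (simp add: case_prod_beta)
    show ?thesis
      unfolding eq
    proof (intro jet_polys.mult jet_polys.const jet_polys_sum finite_splittings)
      fix s assume "s \<in> splittings p q"
      then obtain i1 j1 i2 j2 i3 j3 where s: "s = (i1, j1, i2, j2, i3, j3)"
        and le: "i1 + j1 + 2 \<le> p + q" "i2 + j2 + 2 \<le> p + q" "i3 + j3 + 2 \<le> p + q"
      proof -
        obtain i1 j1 i2 j2 i3 j3 where s: "s = (i1, j1, i2, j2, i3, j3)"
          by (metis prod.exhaust)
        with \<open>s \<in> splittings p q\<close> show thesis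
          by (intro that[OF s]) (auto dest: splittingsD)
      qed
      show "(case s of (i1, j1, i2, j2, i3, j3) \<Rightarrow> \<lambda>a b.
              2 * real i2 * real j3 * forced_coef a b i1 j1 * forced_coef a b i2 j2 * forced_coef a b i3 j3
            + real i2 * real j3 * forced_coef b a i1 j1 * forced_coef a b i2 j2 * forced_coef b a i3 j3
            + real j2 * real i3 * forced_coef b a i1 j1 * forced_coef a b i2 j2 * forced_coef b a i3 j3
            - real i3 * real j3 * (forced_coef a b i1 j1 * forced_coef a b i2 j2 + forced_coef b a i1 j1 * forced_coef b a i2 j2)
                * forced_coef a b i3 j3) \<in> jet_polys L"
        unfolding s prod.case
        by (intro jet_polys_diff jet_polys.add jet_polys.mult jet_polys.const
            IH(1)[OF le(1)] IH(1)[OF le(2)] IH(1)[OF le(3)]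
            IH(2)[OF le(1)] IH(2)[OF le(2)] IH(2)[OF le(3)])
    qed
  qed
qed

lemma P_universal_polynomial:
  assumes "k \<ge> 3" "1 \<le> i" "i \<le> k - 1"
  shows "P_poly k i \<in> jet_polys (k - 2)"
proof -
  have "P_poly k i = (\<lambda>a b. forced_coef a b (k - i) i)"
    by (simp add: P_poly_def fun_eq_iff)
  then show ?thesis
    using assms forced_coef_jet_polys[of "k - 2" "k - i" i] by auto
qed

end

theory Submission
  imports Defs
begin

text \<open>
  Prolong the given jets by zero and let \<open>u\<close>, \<open>v\<close> be the power series with the forced coefficients.
  In the recursion each derivative factor is at most \<open>p q\<close>, which is cancelled by the division
  by \<open>p q\<close>; hence the coefficients are dominated by a
  multiple of \<open>M\<^sup>p\<^sup>+\<^sup>q / ((1 + p)\<^sup>2 (1 + q)\<^sup>2)\<close>, a weight which up to a constant is stable under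
  convolution, and the series converge near the origin. The system for \<open>u\<close> and \<open>v\<close>, multiplied by \<open>x y\<close>, is an
  identity between coefficients, and the factor \<open>x y\<close> is removed by continuity. A change of
  null coordinates locally acts on the two coordinates separately, up to exchanging them, so it
  multiplies \<open>N\<^sub>x\<^sub>y\<close> by a scalar only.
\<close>

subsection \<open>Double power series\<close>

text \<open>The recursion closes because \<open>u\<close> and \<open>v\<close> vanish at the origin:
  clearing the denominator puts the mixed derivative of \<open>u\<close> on the right as well, but
  only multiplied by two factors without constant term, so every factor has degree at most
  \<open>p + q - 2\<close>. The cleared system is cubic, so no series has to be inverted to solve
  it. A plain geometric majorant does not survive the recursion: convolving \<open>M^p M^q\<close>
  with itself costs a factor \<open>(p + 1) (q + 1)\<close>. With inverse-square weights, one part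
  of a split index has a weight comparable to that of the whole, and the weights of the other part
  are summable. Multiplying by \<open>x y\<close> turns differentiation into Euler operators, which
  scale coefficients without shifting indices; the system then is literally the recursion. For a
  general null chart the danger is the second derivative of the chart, which would bring in first
  derivatives of \<open>N\<close>. It drops out because locally one component of the chart depends
  on the first variable only.\<close>

text \<open>Absolute summability is carried along because the rearrangements of double sums rest on
  it, for values in \<open>real ^ 3\<close> as well as in \<open>real\<close>. One radius serves
  both variables, so the domain is a square; nothing is said about \<open>f\<close> outside
  it.\<close>

definition pser ::
    "(nat \<Rightarrow> nat \<Rightarrow> 'b::banach) \<Rightarrow> real \<Rightarrow> (real \<times> real \<Rightarrow> 'b) \<Rightarrow> bool" where
  "pser c r f \<longleftrightarrow> r > 0 \<and>
     (\<forall>s. 0 \<le> s \<longrightarrow> s < r \<longrightarrow> (\<lambda>(i, j). norm (c i j) * s ^ (i + j)) summable_on UNIV) \<and>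
     (\<forall>x y. \<bar>x\<bar> < r \<longrightarrow> \<bar>y\<bar> < r \<longrightarrow> ((\<lambda>(i, j). (x ^ i * y ^ j) *\<^sub>R c i j) has_sum f (x, y)) UNIV)"

lemma pserI:
  assumes "r > 0"
    and "\<And>s. 0 \<le> s \<Longrightarrow> s < r \<Longrightarrow> (\<lambda>(i, j). norm (c i j) * s ^ (i + j)) summable_on UNIV"
    and "\<And>x y. \<bar>x\<bar> < r \<Longrightarrow> \<bar>y\<bar> < r \<Longrightarrow> ((\<lambda>(i, j). (x ^ i * y ^ j) *\<^sub>R c i j) has_sum f (x, y)) UNIV"
  shows "pser c r f"
  using assms unfolding pser_def by blast

lemma
  assumes "pser c r f"
  shows pser_pos: "r > 0"
    and pser_summable: "0 \<le> s \<Longrightarrow> s < r \<Longrightarrow> (\<lambda>(i, j). norm (c i j) * s ^ (i + j)) summable_on UNIV"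
    and pser_has_sum: "\<bar>x\<bar> < r \<Longrightarrow> \<bar>y\<bar> < r \<Longrightarrow>
      ((\<lambda>(i, j). (x ^ i * y ^ j) *\<^sub>R c i j) has_sum f (x, y)) UNIV"
  using assms unfolding pser_def by blast+

lemma power_prod_le:
  fixes x y s :: real
  assumes "\<bar>x\<bar> \<le> s" "\<bar>y\<bar> \<le> s"
  shows "\<bar>x ^ i * y ^ j\<bar> \<le> s ^ (i + j)"
  unfolding power_add abs_mult power_abs using assms
  by (intro mult_mono power_mono) auto

lemma pser_mono:
  assumes "pser c r f" "0 < r'" "r' \<le> r"
  shows "pser c r' f"
  using assms unfolding pser_def by auto

lemma pser_at_0:
  assumes "pser c r f"
  shows "f (0, 0) = c 0 0"
proof -
  have "((\<lambda>(i, j). (0 ^ i * 0 ^ j) *\<^sub>R c i j) has_sum f (0, 0)) UNIV"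
    using pser_has_sum[OF assms, of 0 0] pser_pos[OF assms] by simp
  moreover have "((\<lambda>(i, j). ((0::real) ^ i * 0 ^ j) *\<^sub>R c i j) has_sum c 0 0) UNIV"
    by (rule has_sum_finite_neutralI[of "{(0, 0)}"]) (auto simp: power_0_left split: if_splits)
  ultimately show ?thesis
    by (rule has_sum_unique)
qed

lemma pser_add:
  assumes "pser c r f" "pser d r g"
  shows "pser (\<lambda>i j. c i j + d i j) r (\<lambda>p. f p + g p)"
proof (rule pserI)
  fix s :: real assume s: "0 \<le> s" "s < r"
  have "(\<lambda>p. (case p of (i, j) \<Rightarrow> norm (c i j) * s ^ (i + j)) + (case p of (i, j) \<Rightarrow> norm (d i j) * s ^ (i + j)))
      summable_on UNIV"
    by (intro summable_on_add pser_summable[OF assms(1) s] pser_summable[OF assms(2) s])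
  then show "(\<lambda>(i, j). norm (c i j + d i j) * s ^ (i + j)) summable_on UNIV"
    by (rule summable_on_comparison_test)
      (auto simp flip: distrib_right simp: s norm_triangle_ineq intro!: mult_right_mono)
next
  fix x y :: real assume "\<bar>x\<bar> < r" "\<bar>y\<bar> < r"
  from has_sum_add[OF pser_has_sum[OF assms(1) this] pser_has_sum[OF assms(2) this]]
  show "((\<lambda>(i, j). (x ^ i * y ^ j) *\<^sub>R (c i j + d i j)) has_sum f (x, y) + g (x, y)) UNIV"
    by (simp add: case_prod_unfold scaleR_add_right)
qed (use pser_pos assms in blast)

lemma pser_bounded_linear:
  assumes "pser c r f" "bounded_linear h"
  shows "pser (\<lambda>i j. h (c i j)) r (\<lambda>p. h (f p))"
proof (rule pserI)
  interpret bounded_linear h by fact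
  fix s :: real assume s: "0 \<le> s" "s < r"
  obtain K where K: "\<And>x. norm (h x) \<le> norm x * K"
    using bounded by blast
  have "(\<lambda>p. (case p of (i, j) \<Rightarrow> norm (c i j) * s ^ (i + j)) * K) summable_on UNIV"
    by (intro summable_on_cmult_left pser_summable[OF assms(1) s])
  then show "(\<lambda>(i, j). norm (h (c i j)) * s ^ (i + j)) summable_on UNIV"
  proof (rule summable_on_comparison_test)
    fix p :: "nat \<times> nat"
    show "(case p of (i, j) \<Rightarrow> norm (h (c i j)) * s ^ (i + j)) \<le> (case p of (i, j) \<Rightarrow> norm (c i j) * s ^ (i + j)) * K"
      using mult_right_mono[OF K[of "c (fst p) (snd p)"], of "s ^ (fst p + snd p)"] s
      by (simp add: case_prod_unfold mult_ac)
  qed (use s in auto)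
next
  interpret bounded_linear h by fact
  fix x y :: real assume "\<bar>x\<bar> < r" "\<bar>y\<bar> < r"
  from has_sum_bounded_linear[OF assms(2) pser_has_sum[OF assms(1) this]]
  show "((\<lambda>(i, j). (x ^ i * y ^ j) *\<^sub>R h (c i j)) has_sum h (f (x, y))) UNIV"
    by (simp add: case_prod_unfold o_def scaleR)
qed (use pser_pos assms in blast)

text \<open>Fubini: absolute summability over \<open>m\<close>, \<open>i\<close>, \<open>j\<close>
  jointly allows summing over \<open>m\<close> first, coefficient by coefficient. Products,
  composition and re-expansion are instances, with \<open>m\<close> a monomial of the first factor,
  an exponent of a power, and a monomial of the old expansion.\<close>

lemma pser_infsum:
  fixes F :: "'k \<Rightarrow> nat \<Rightarrow> nat \<Rightarrow> 'b::banach"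
  assumes r: "r > 0"
    and summ: "\<And>s. 0 \<le> s \<Longrightarrow> s < r \<Longrightarrow> (\<lambda>(m, i, j). norm (F m i j) * s ^ (i + j)) summable_on UNIV"
    and g: "\<And>m x y. \<bar>x\<bar> < r \<Longrightarrow> \<bar>y\<bar> < r \<Longrightarrow>
      ((\<lambda>(i, j). (x ^ i * y ^ j) *\<^sub>R F m i j) has_sum g m (x, y)) UNIV"
    and f: "\<And>x y. \<bar>x\<bar> < r \<Longrightarrow> \<bar>y\<bar> < r \<Longrightarrow> ((\<lambda>m. g m (x, y)) has_sum f (x, y)) UNIV"
  shows "pser (\<lambda>i j. \<Sum>\<^sub>\<infinity>m. F m i j) r f"
    and "(\<lambda>m. F m i j) summable_on UNIV"
proof -
  have summ': "(\<lambda>((i, j), m). norm (F m i j) * s ^ (i + j)) summable_on UNIV \<times> UNIV"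
    if "0 \<le> s" "s < r" for s
  proof -
    have "(\<lambda>(m, i, j). norm (F m i j) * s ^ (i + j)) summable_on UNIV \<times> UNIV"
      using summ[OF that] by simp
    then show ?thesis
      by (subst (asm) summable_on_swap) (simp add: case_prod_unfold)
  qed
  have absF: "(\<lambda>m. norm (F m i j)) summable_on UNIV" for i j
  proof -
    \<comment> \<open>Any radius strictly between 0 and \<open>r\<close> works; being positive, its
      power can be divided out again.\<close>
    have "(\<lambda>m. norm (F m i j) * (r / 2) ^ (i + j)) summable_on UNIV"
      using summable_on_SigmaD1[of "\<lambda>(i, j) m. norm (F m i j) * (r/2) ^ (i + j)" UNIV "\<lambda>_. UNIV" "(i, j)"]
        summ'[of "r/2"] r by (simp add: case_prod_unfold)
    from summable_on_cmult_left[OF this, of "1 / (r / 2) ^ (i + j)"] r show ?thesis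
      by simp
  qed
  then show sF: "(\<lambda>m. F m i j) summable_on UNIV" for i j
    by (rule abs_summable_summable)
  show "pser (\<lambda>i j. \<Sum>\<^sub>\<infinity>m. F m i j) r f"
  proof (rule pserI[OF r])
    fix s :: real assume s: "0 \<le> s" "s < r"
    have "(\<lambda>p. \<Sum>\<^sub>\<infinity>m. (case p of (i, j) \<Rightarrow> norm (F m i j) * s ^ (i + j))) summable_on UNIV"
      using summable_on_Sigma_banach[of "\<lambda>(i, j) m. norm (F m i j) * s ^ (i + j)" UNIV "\<lambda>_. UNIV"]
        summ'[OF s] by (simp add: case_prod_unfold)
    then show "(\<lambda>(i, j). norm (\<Sum>\<^sub>\<infinity>m. F m i j) * s ^ (i + j)) summable_on UNIV"
    proof (rule summable_on_comparison_test)
      fix p :: "nat \<times> nat"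
      obtain i j where p: "p = (i, j)" by fastforce
      have "norm (\<Sum>\<^sub>\<infinity>m. F m i j) * s ^ (i + j) \<le> (\<Sum>\<^sub>\<infinity>m. norm (F m i j)) * s ^ (i + j)"
        using s by (intro mult_right_mono norm_infsum_bound absF) auto
      also have "\<dots> = (\<Sum>\<^sub>\<infinity>m. norm (F m i j) * s ^ (i + j))"
        using absF by (intro infsum_cmult_left[symmetric]) auto
      finally show "(case p of (i, j) \<Rightarrow> norm (\<Sum>\<^sub>\<infinity>m. F m i j) * s ^ (i + j))
          \<le> (\<Sum>\<^sub>\<infinity>m. (case p of (i, j) \<Rightarrow> norm (F m i j) * s ^ (i + j)))"
        by (simp add: p)
    qed (use s in auto)
  next
    fix x y :: real assume xy: "\<bar>x\<bar> < r" "\<bar>y\<bar> < r"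
    define s where "s = max \<bar>x\<bar> \<bar>y\<bar>"
    have s: "0 \<le> s" "s < r" "\<bar>x\<bar> \<le> s" "\<bar>y\<bar> \<le> s"
      using xy by (auto simp: s_def)
    have "(\<lambda>q. norm (case q of (m, i, j) \<Rightarrow> (x ^ i * y ^ j) *\<^sub>R F m i j)) summable_on UNIV"
      by (rule summable_on_comparison_test[OF summ[OF s(1,2)]])
        (auto simp: mult.commute[of "norm _"] intro!: mult_right_mono power_prod_le[OF s(3,4)])
    then have "(\<lambda>(m, i, j). (x ^ i * y ^ j) *\<^sub>R F m i j) summable_on UNIV \<times> UNIV"
      unfolding UNIV_Times_UNIV by (rule abs_summable_summable)
    then have "((\<lambda>(m, i, j). (x ^ i * y ^ j) *\<^sub>R F m i j) has_sum f (x, y)) (UNIV \<times> UNIV)"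
      by (intro has_sum_SigmaI[OF _ f[OF xy]]) (use g[OF xy] in \<open>auto simp: case_prod_unfold\<close>)
    then have "((\<lambda>(p, m). case p of (i, j) \<Rightarrow> (x ^ i * y ^ j) *\<^sub>R F m i j) has_sum f (x, y)) (UNIV \<times> UNIV)"
      by (subst (asm) has_sum_swap) (simp add: case_prod_unfold)
    then show "((\<lambda>(i, j). (x ^ i * y ^ j) *\<^sub>R (\<Sum>\<^sub>\<infinity>m. F m i j)) has_sum f (x, y)) UNIV"
    proof (rule has_sum_SigmaD)
      fix p :: "nat \<times> nat"
      obtain i j where p: "p = (i, j)" by fastforce
      have "((\<lambda>m. (x ^ i * y ^ j) *\<^sub>R F m i j) has_sum (x ^ i * y ^ j) *\<^sub>R (\<Sum>\<^sub>\<infinity>m. F m i j)) UNIV"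
        by (intro has_sum_scaleR has_sum_infsum sF)
      then show "((\<lambda>m. case (p, m) of (p, m) \<Rightarrow> case p of (i, j) \<Rightarrow> (x ^ i * y ^ j) *\<^sub>R F m i j) has_sum
          (case p of (i, j) \<Rightarrow> (x ^ i * y ^ j) *\<^sub>R (\<Sum>\<^sub>\<infinity>m. F m i j))) UNIV"
        by (simp add: p)
    qed
  qed
qed

subsection \<open>Products and composition\<close>

definition conv :: "(nat \<Rightarrow> nat \<Rightarrow> real) \<Rightarrow> (nat \<Rightarrow> nat \<Rightarrow> real) \<Rightarrow> nat \<Rightarrow> nat \<Rightarrow> real" where
  "conv c d p q = (\<Sum>i\<le>p. \<Sum>j\<le>q. c i j * d (p - i) (q - j))"

text \<open>The effect of multiplying by a monomial of degrees \<open>k\<close> and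
  \<open>l\<close>; the guard keeps truncated subtraction from producing spurious terms.\<close>

lemma has_sum_shift_index:
  fixes f :: "nat \<Rightarrow> nat \<Rightarrow> 'b::{comm_monoid_add, topological_space}"
  assumes "((\<lambda>(i, j). f i j) has_sum S) UNIV"
  shows "((\<lambda>(i, j). if k \<le> i \<and> l \<le> j then f (i - k) (j - l) else 0) has_sum S) UNIV"
proof -
  have "((\<lambda>(i, j). f (i - k) (j - l)) has_sum S) {(i, j). k \<le> i \<and> l \<le> j}"
    using assms
    by (subst (asm) has_sum_reindex_bij_witness[where T = "{(i, j). k \<le> i \<and> l \<le> j}"
          and i = "\<lambda>(i, j). (i - k, j - l)" and j = "\<lambda>(i, j). (i + k, j + l)"
          and h = "\<lambda>(i, j). f (i - k) (j - l)" and s' = S]) auto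
  then show ?thesis
    by (rule has_sum_cong_neutral[THEN iffD1, rotated -1]) (auto split: if_splits)
qed

lemma summable_shift_index:
  fixes f :: "nat \<Rightarrow> nat \<Rightarrow> 'b::{comm_monoid_add, topological_space}"
  assumes "(\<lambda>(i, j). f i j) summable_on UNIV"
  shows "(\<lambda>(i, j). if k \<le> i \<and> l \<le> j then f (i - k) (j - l) else 0) summable_on UNIV"
  using assms has_sum_shift_index unfolding summable_on_def by blast

lemma pser_mult:
  fixes f g :: "real \<times> real \<Rightarrow> real"
  assumes f: "pser c r f" and g: "pser d r g"
  shows "pser (conv c d) r (\<lambda>p. f p * g p)"
proof -
  \<comment> \<open>\<open>F m\<close> holds the coefficients of \<open>g\<close> times the monomial
    of \<open>f\<close> with index \<open>m\<close>. Only finitely many \<open>m\<close> reach a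
    given coefficient, and their sum is \<open>conv c d\<close>.\<close>
  define F where "F = (\<lambda>m k l. if fst m \<le> k \<and> snd m \<le> l
      then c (fst m) (snd m) * d (k - fst m) (l - snd m) else 0)"
  have "pser (\<lambda>k l. \<Sum>\<^sub>\<infinity>m. F m k l) r (\<lambda>p. f p * g p)"
  proof (rule pser_infsum(1)[where g = "\<lambda>m p. c (fst m) (snd m) * (fst p ^ fst m * snd p ^ snd m) * g p"])
    fix s :: real assume s: "0 \<le> s" "s < r"
    define D where "D = (\<Sum>\<^sub>\<infinity>(k, l). norm (d k l) * s ^ (k + l))"
    have D: "((\<lambda>(k, l). norm (d k l) * s ^ (k + l)) has_sum D) UNIV"
      unfolding D_def by (intro has_sum_infsum pser_summable[OF g s])
    have "(\<lambda>(m, i, j). norm (F m i j) * s ^ (i + j)) summable_on UNIV \<times> UNIV"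
    proof (rule summable_on_SigmaI)
      fix m :: "nat \<times> nat"
      obtain i j where m: "m = (i, j)" by fastforce
      have "((\<lambda>(k, l). norm (c i j) * s ^ (i + j) * (norm (d k l) * s ^ (k + l)))
          has_sum norm (c i j) * s ^ (i + j) * D) UNIV"
        using has_sum_cmult_right[OF D] by (simp add: case_prod_unfold)
      from has_sum_shift_index[OF this, of i j]
      show "((\<lambda>p. case (m, p) of (m, i, j) \<Rightarrow> norm (F m i j) * s ^ (i + j)) has_sum
          norm (c (fst m) (snd m)) * s ^ (fst m + snd m) * D) UNIV"
        unfolding m fst_conv snd_conv
        by (rule has_sum_cong[THEN iffD1, rotated]) (auto simp: F_def norm_mult abs_mult le_iff_add power_add)
      show "(\<lambda>m. norm (c (fst m) (snd m)) * s ^ (fst m + snd m) * D) summable_on UNIV"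
        using summable_on_cmult_left[OF pser_summable[OF f s]] by (simp add: case_prod_unfold)
    qed (use s in auto)
    then show "(\<lambda>(m, i, j). norm (F m i j) * s ^ (i + j)) summable_on UNIV"
      by simp
  next
    fix m :: "nat \<times> nat" and x y :: real assume xy: "\<bar>x\<bar> < r" "\<bar>y\<bar> < r"
    obtain i j where m: "m = (i, j)" by fastforce
    have "((\<lambda>(k, l). c i j * (x ^ i * y ^ j) * ((x ^ k * y ^ l) *\<^sub>R d k l))
        has_sum c i j * (x ^ i * y ^ j) * g (x, y)) UNIV"
      using has_sum_cmult_right[OF pser_has_sum[OF g xy]] by (simp add: case_prod_unfold)
    from has_sum_shift_index[OF this, of i j]
    show "((\<lambda>(i, j). (x ^ i * y ^ j) *\<^sub>R F m i j) has_sum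
        c (fst m) (snd m) * (fst (x, y) ^ fst m * snd (x, y) ^ snd m) * g (x, y)) UNIV"
      by (subst (asm) has_sum_cong) (auto simp: m F_def le_iff_add power_add)
  next
    fix x y :: real assume xy: "\<bar>x\<bar> < r" "\<bar>y\<bar> < r"
    show "((\<lambda>m. c (fst m) (snd m) * (fst (x, y) ^ fst m * snd (x, y) ^ snd m) * g (x, y)) has_sum
        f (x, y) * g (x, y)) UNIV"
      using has_sum_cmult_left[OF pser_has_sum[OF f xy], of "g (x, y)"] by (simp add: case_prod_unfold mult_ac)
  qed (use pser_pos f in blast)
  moreover have "(\<lambda>k l. \<Sum>\<^sub>\<infinity>m. F m k l) = conv c d"
  proof (intro ext)
    fix k l
    have "((\<lambda>m. F m k l) has_sum (\<Sum>(i, j)\<in>{..k} \<times> {..l}. c i j * d (k - i) (l - j))) UNIV"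
      by (rule has_sum_finite_neutralI[of "{..k} \<times> {..l}"]) (auto simp: F_def intro!: sum.cong)
    then show "(\<Sum>\<^sub>\<infinity>m. F m k l) = conv c d k l"
      unfolding conv_def sum.cartesian_product by (rule infsumI)
  qed
  ultimately show ?thesis
    by simp
qed

lemma pser_const: "r > 0 \<Longrightarrow> pser (\<lambda>i j. if i = 0 \<and> j = 0 then a else 0) r (\<lambda>_. a)"
proof (rule pserI)
  fix s :: real
  show "(\<lambda>(i, j). norm (if i = 0 \<and> j = 0 then a else 0) * s ^ (i + j)) summable_on UNIV"
    by (rule has_sum_imp_summable, rule has_sum_finite_neutralI[of "{(0, 0)}"])
      (auto split: if_splits)
next
  fix x y :: real
  show "((\<lambda>(i, j). (x ^ i * y ^ j) *\<^sub>R (if i = 0 \<and> j = 0 then a else 0)) has_sum a) UNIV"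
    by (rule has_sum_finite_neutralI[of "{(0, 0)}"]) (auto split: if_splits)
qed

text \<open>The series of norms has the same radius. It dominates \<open>f\<close> in the
  composition, and its own derivatives give the absolute summability of the differentiated
  series.\<close>

lemma pser_norm:
  assumes "pser c r f"
  shows "pser (\<lambda>i j. norm (c i j)) r (\<lambda>(x, y). \<Sum>\<^sub>\<infinity>(i, j). x ^ i * y ^ j * norm (c i j))"
proof (rule pserI)
  fix x y :: real assume xy: "\<bar>x\<bar> < r" "\<bar>y\<bar> < r"
  define s where "s = max \<bar>x\<bar> \<bar>y\<bar>"
  have s: "0 \<le> s" "s < r" "\<bar>x\<bar> \<le> s" "\<bar>y\<bar> \<le> s"
    using xy by (auto simp: s_def)
  have "(\<lambda>q. norm (case q of (i, j) \<Rightarrow> x ^ i * y ^ j * norm (c i j))) summable_on UNIV"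
    by (rule summable_on_comparison_test[OF pser_summable[OF assms s(1,2)]])
      (auto simp: mult.commute[of "norm _"] abs_mult[of _ "norm _"]
        intro!: mult_right_mono power_prod_le[OF s(3,4)])
  then show "((\<lambda>(i, j). (x ^ i * y ^ j) *\<^sub>R norm (c i j)) has_sum
      (case (x, y) of (x, y) \<Rightarrow> \<Sum>\<^sub>\<infinity>(i, j). x ^ i * y ^ j * norm (c i j))) UNIV"
    by (auto simp: abs_summable_summable intro!: has_sum_infsum)
qed (use pser_summable pser_pos assms in auto)

primrec conv_power :: "(nat \<Rightarrow> nat \<Rightarrow> real) \<Rightarrow> nat \<Rightarrow> nat \<Rightarrow> nat \<Rightarrow> real" where
  "conv_power c 0 = (\<lambda>i j. if i = 0 \<and> j = 0 then 1 else 0)"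
| "conv_power c (Suc k) = conv c (conv_power c k)"

lemma pser_power:
  fixes f :: "real \<times> real \<Rightarrow> real"
  assumes "pser c r f"
  shows "pser (conv_power c k) r (\<lambda>p. f p ^ k)"
  by (induction k) (use pser_const[of r 1] pser_pos assms in \<open>auto intro: pser_mult\<close>)

lemma abs_conv_le:
  assumes "\<And>i j. \<bar>c i j\<bar> \<le> c' i j" "\<And>i j. \<bar>d i j\<bar> \<le> d' i j"
  shows "\<bar>conv c d p q\<bar> \<le> conv c' d' p q"
  unfolding conv_def
  by (intro order.trans[OF sum_abs] sum_mono)
    (auto simp: abs_mult intro!: mult_mono assms order.trans[OF abs_ge_zero])

lemma abs_conv_power_le: "\<bar>conv_power c k i j\<bar> \<le> conv_power (\<lambda>i j. \<bar>c i j\<bar>) k i j"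
  by (induction k arbitrary: i j) (auto intro: abs_conv_le)

text \<open>The series of absolute values has no constant term, so its value at
  \<open>(s, s)\<close> is small for small \<open>s\<close>. Where it stays below \<open>R\<close>,
  it dominates the expansions of all powers of \<open>f\<close> inserted into the series of
  \<open>H\<close>.\<close>

lemma pser_compose:
  fixes f :: "real \<times> real \<Rightarrow> real" and h :: "nat \<Rightarrow> real"
  assumes f: "pser c r f" and "c 0 0 = 0" and "R > 0"
    and H: "\<And>t. \<bar>t\<bar> < R \<Longrightarrow> (\<lambda>k. h k * t ^ k) sums H t"
  obtains d r' where "0 < r'" "r' \<le> r" "pser d r' (\<lambda>p. H (f p))"
proof -
  define g where "g = (\<lambda>(x, y). \<Sum>\<^sub>\<infinity>(i, j). x ^ i * y ^ j * \<bar>c i j\<bar>)"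
  have g: "pser (\<lambda>i j. \<bar>c i j\<bar>) r g"
    using pser_norm[OF f] by (simp add: g_def)
  have r: "r > 0"
    using f by (rule pser_pos)
  have g_diag: "((\<lambda>(i, j). s ^ (i + j) * \<bar>c i j\<bar>) has_sum g (s, s)) UNIV" if "\<bar>s\<bar> < r" for s
    using pser_has_sum[OF g that that] by (simp add: power_add)
  have g_nonneg: "g (s, s) \<ge> 0" if "0 \<le> s" "s < r" for s
    by (rule has_sum_nonneg[OF g_diag]) (use that in auto)
  define t where "t = r / 2"
  have t: "0 < t" "t < r"
    using r by (auto simp: t_def)
  \<comment> \<open>Without constant term, \<open>g (s, s) \<le> s / t * g (t, t)\<close> for
    \<open>s \<le> t\<close>. This radius brings the right side below \<open>R\<close>; the summand
    \<open>R\<close> in the denominator ensures \<open>r' \<le> t\<close> and covers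
    \<open>g (t, t) = 0\<close>.\<close>
  define r' where "r' = t * (R / (R + g (t, t)))"
  have gt: "g (t, t) \<ge> 0"
    using g_nonneg t by simp
  have r': "0 < r'" "r' \<le> t"
    using t gt \<open>R > 0\<close> by (auto simp: r'_def divide_simps intro!: mult_pos_pos)
  have small: "g (s, s) < R" if s: "0 \<le> s" "s < r'" for s
  proof -
    have "((\<lambda>(i, j). s / t * (t ^ (i + j) * \<bar>c i j\<bar>)) has_sum s / t * g (t, t)) UNIV"
      using has_sum_cmult_right[OF g_diag[of t], of "s / t"] t by (simp add: case_prod_unfold)
    then have "g (s, s) \<le> s / t * g (t, t)"
    proof (rule has_sum_mono[OF g_diag, rotated])
      fix p :: "nat \<times> nat"
      obtain i j where p: "p = (i, j)" by fastforce
      show "(case p of (i, j) \<Rightarrow> s ^ (i + j) * \<bar>c i j\<bar>) \<le> (case p of (i, j) \<Rightarrow> s / t * (t ^ (i + j) * \<bar>c i j\<bar>))"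
      proof (cases "i + j")
        case 0
        with assms(2) show ?thesis by (simp add: p)
      next
        case (Suc n)
        have "s * s ^ n \<le> s * t ^ n"
          using s r' by (intro mult_left_mono power_mono) auto
        then show ?thesis
          using t mult_right_mono[of _ _ "\<bar>c i j\<bar>"] by (simp add: p Suc mult.assoc[symmetric])
      qed
    qed (use s r' t in auto)
    also have "\<dots> \<le> r' / t * g (t, t)"
      using s t gt by (intro mult_right_mono divide_right_mono) auto
    also have "\<dots> < R"
      using t gt \<open>R > 0\<close> by (simp add: r'_def divide_simps)
    finally show ?thesis .
  qed
  have f_le: "\<bar>f (x, y)\<bar> < R" if xy: "\<bar>x\<bar> < r'" "\<bar>y\<bar> < r'" for x y
  proof -
    define s where "s = max \<bar>x\<bar> \<bar>y\<bar>"
    have s: "0 \<le> s" "s < r'" "\<bar>x\<bar> \<le> s" "\<bar>y\<bar> \<le> s"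
      using xy by (auto simp: s_def)
    have "\<bar>x ^ i * y ^ j * c i j\<bar> \<le> s ^ (i + j) * \<bar>c i j\<bar>" for i j
      unfolding abs_mult[of _ "c i j"] using power_prod_le[OF s(3,4)] by (intro mult_right_mono) auto
    then have term_le: "x ^ i * y ^ j * c i j \<le> s ^ (i + j) * \<bar>c i j\<bar>"
        "- (x ^ i * y ^ j * c i j) \<le> s ^ (i + j) * \<bar>c i j\<bar>" for i j
      by (simp_all add: abs_le_iff)
    have "f (x, y) \<le> g (s, s)"
      by (rule has_sum_mono[OF pser_has_sum[OF f] g_diag])
        (use xy s r' t term_le in auto)
    moreover have "- f (x, y) \<le> g (s, s)"
      by (rule has_sum_mono[OF has_sum_uminusI[OF pser_has_sum[OF f]] g_diag])
        (use xy s r' t term_le in auto)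
    ultimately show ?thesis
      using small[OF s(1,2)] by simp
  qed
  have abs_h: "(\<lambda>k. norm (h k * t ^ k)) summable_on UNIV" if "0 \<le> t" "t < R" for t
  proof -
    \<comment> \<open>Convergence at the midpoint of \<open>t\<close> and \<open>R\<close> yields
      absolute convergence at \<open>t\<close>.\<close>
    have "summable (\<lambda>k. h k * ((t + R) / 2) ^ k)"
      using that by (intro sums_summable[OF H]) auto
    from powser_insidea[OF this, of t] have "summable (\<lambda>k. norm (h k * t ^ k))"
      using that by simp
    then show ?thesis
      by (intro norm_summable_imp_summable_on) simp
  qed
  define F where "F = (\<lambda>k i j. h k * conv_power c k i j)"
  have "pser (\<lambda>i j. \<Sum>\<^sub>\<infinity>k. F k i j) r' (\<lambda>p. H (f p))"
  proof (rule pser_infsum(1)[where g = "\<lambda>k p. h k * f p ^ k"])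
    fix s :: real assume s: "0 \<le> s" "s < r'"
    have "(\<lambda>(k, i, j). norm (h k) * (s ^ (i + j) * conv_power (\<lambda>i j. \<bar>c i j\<bar>) k i j)) summable_on UNIV \<times> UNIV"
    proof (rule summable_on_SigmaI)
      fix k
      show "((\<lambda>p. case (k, p) of (k, i, j) \<Rightarrow> norm (h k) * (s ^ (i + j) * conv_power (\<lambda>i j. \<bar>c i j\<bar>) k i j))
          has_sum norm (h k) * g (s, s) ^ k) UNIV"
        using has_sum_cmult_right[OF pser_has_sum[OF pser_power[OF g, of k], of s s], of "norm (h k)"] s r' t
        by (simp add: case_prod_unfold power_add)
      show "(\<lambda>k. norm (h k) * g (s, s) ^ k) summable_on UNIV"
        using abs_h[of "g (s, s)"] small[OF s] g_nonneg[of s] s r' t by (simp add: abs_mult)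
    qed (use s order.trans[OF abs_ge_zero abs_conv_power_le] in \<open>auto intro!: mult_nonneg_nonneg\<close>)
    then show "(\<lambda>(k, i, j). norm (F k i j) * s ^ (i + j)) summable_on UNIV"
      unfolding UNIV_Times_UNIV
      by (rule summable_on_comparison_test)
        (use s abs_conv_power_le[of c] in \<open>auto simp: F_def abs_mult mult_ac intro!: mult_left_mono\<close>)
  next
    fix k and x y :: real assume "\<bar>x\<bar> < r'" "\<bar>y\<bar> < r'"
    then have "\<bar>x\<bar> < r" "\<bar>y\<bar> < r"
      using r' t by auto
    from has_sum_cmult_right[OF pser_has_sum[OF pser_power[OF f] this], of "h k"]
    show "((\<lambda>(i, j). (x ^ i * y ^ j) *\<^sub>R F k i j) has_sum h k * f (x, y) ^ k) UNIV"
      by (simp add: case_prod_unfold F_def mult_ac)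
  next
    fix x y :: real assume xy: "\<bar>x\<bar> < r'" "\<bar>y\<bar> < r'"
    from f_le[OF this] have "(\<lambda>k. h k * f (x, y) ^ k) sums H (f (x, y))"
      by (rule H)
    moreover have "summable (\<lambda>k. norm (h k * f (x, y) ^ k))"
      using abs_h[of "\<bar>f (x, y)\<bar>"] f_le[OF xy]
      by (intro summable_on_imp_summable) (simp add: abs_mult power_abs)
    ultimately show "((\<lambda>k. h k * f (x, y) ^ k) has_sum H (f (x, y))) UNIV"
      by (intro norm_summable_imp_has_sum)
  qed fact
  then show thesis
    using r' t by (intro that[of r']) auto
qed

subsection \<open>Re-expansion and derivatives\<close>

text \<open>Binomial expansion of every monomial about \<open>(a, b)\<close>. Applied to
  \<open>\<bar>a\<bar>\<close> and \<open>\<bar>b\<bar>\<close>, the same identity sums the norms to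
  values of the original absolute series at \<open>\<bar>a\<bar> + s\<close> and
  \<open>\<bar>b\<bar> + s\<close>, hence the loss of \<open>max \<bar>a\<bar> \<bar>b\<bar>\<close>
  in the radius.\<close>

lemma pser_shift:
  assumes f: "pser c r f" and p: "\<bar>a\<bar> < r" "\<bar>b\<bar> < r"
  defines "F \<equiv> \<lambda>(i, j) k l. (real (i choose k) * real (j choose l) * a ^ (i - k) * b ^ (j - l)) *\<^sub>R c i j"
  shows "pser (\<lambda>k l. \<Sum>\<^sub>\<infinity>m. F m k l) (r - max \<bar>a\<bar> \<bar>b\<bar>) (\<lambda>(x, y). f (a + x, b + y))"
    and "(\<lambda>m. F m k l) summable_on UNIV"
proof -
  define \<rho> where "\<rho> = r - max \<bar>a\<bar> \<bar>b\<bar>"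
  define w where "w = (\<lambda>i j k l a b. real (i choose k) * real (j choose l) * a ^ (i - k) * b ^ (j - l))"
  have F: "F (i, j) k l = w i j k l a b *\<^sub>R c i j" for i j k l
    by (simp add: F_def w_def)
  have binom: "(\<Sum>(k, l)\<in>{..i} \<times> {..j}. (x ^ k * y ^ l) * w i j k l a b) = (a + x) ^ i * (b + y) ^ j"
    for i j and a b x y :: real
    unfolding add.commute[of a] add.commute[of b] binomial_ring sum_product sum.cartesian_product
    by (intro sum.cong) (auto simp: w_def)
  have w_0: "w i j (fst q) (snd q) a b = 0" if "q \<in> UNIV - {..i} \<times> {..j}" for i j q a b
    using that by (cases "fst q \<le> i") (auto simp: w_def not_le binomial_eq_0 mem_Times_iff)
  have abs_w: "\<bar>w i j k l a b\<bar> = w i j k l \<bar>a\<bar> \<bar>b\<bar>" for i j k l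
    by (simp add: w_def abs_mult power_abs)
  have summ: "(\<lambda>(m, k, l). norm (F m k l) * s ^ (k + l)) summable_on UNIV" if s: "0 \<le> s" "s < \<rho>" for s
  proof -
    define t where "t = max \<bar>a\<bar> \<bar>b\<bar> + s"
    have t: "0 \<le> t" "t < r" "\<bar>\<bar>a\<bar> + s\<bar> \<le> t" "\<bar>\<bar>b\<bar> + s\<bar> \<le> t"
      using s by (auto simp: t_def \<rho>_def)
    have "(\<lambda>(m, k, l). norm (F m k l) * s ^ (k + l)) summable_on UNIV \<times> UNIV"
    proof (rule summable_on_SigmaI)
      fix m :: "nat \<times> nat"
      obtain i j where m: "m = (i, j)" by fastforce
      show "((\<lambda>p. case (m, p) of (m, k, l) \<Rightarrow> norm (F m k l) * s ^ (k + l)) has_sum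
          norm (c (fst m) (snd m)) * ((\<bar>a\<bar> + s) ^ fst m * (\<bar>b\<bar> + s) ^ snd m)) UNIV"
        unfolding m fst_conv snd_conv binom[symmetric] sum_distrib_left
      proof (rule has_sum_finite_neutralI[of "{..i} \<times> {..j}"])
        fix q assume "q \<in> UNIV - {..i} \<times> {..j}"
        from w_0[OF this] show "(case ((i, j), q) of (m, k, l) \<Rightarrow> norm (F m k l) * s ^ (k + l)) = 0"
          by (simp add: F abs_w case_prod_unfold)
      qed (use s in \<open>auto simp: F abs_w power_add intro!: sum.cong\<close>)
      have "(\<lambda>(i, j). norm (c i j) * ((\<bar>a\<bar> + s) ^ i * (\<bar>b\<bar> + s) ^ j)) summable_on UNIV"
      proof (rule summable_on_comparison_test[OF pser_summable[OF f t(1,2)]])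
        fix q :: "nat \<times> nat"
        obtain i j where q: "q = (i, j)" by fastforce
        have "(\<bar>a\<bar> + s) ^ i * (\<bar>b\<bar> + s) ^ j \<le> t ^ (i + j)"
          using power_prod_le[OF t(3,4), of i j] by linarith
        then show "(case q of (i, j) \<Rightarrow> norm (c i j) * ((\<bar>a\<bar> + s) ^ i * (\<bar>b\<bar> + s) ^ j))
            \<le> (case q of (i, j) \<Rightarrow> norm (c i j) * t ^ (i + j))"
          by (simp add: q mult_left_mono)
      qed (use s in auto)
      then show "(\<lambda>m. norm (c (fst m) (snd m)) * ((\<bar>a\<bar> + s) ^ fst m * (\<bar>b\<bar> + s) ^ snd m)) summable_on UNIV"
        by (simp add: case_prod_unfold)
    qed (use s in auto)
    then show ?thesis by simp
  qed
  have main: "pser (\<lambda>k l. \<Sum>\<^sub>\<infinity>m. F m k l) \<rho> (\<lambda>(x, y). f (a + x, b + y)) \<and> (\<lambda>m. F m k l) summable_on UNIV"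
  \<comment> \<open>Both conjuncts come from the same pair of conclusions, so each premise arises
    twice.\<close>
  proof (rule conjI; rule pser_infsum[OF _ summ, where
        g = "\<lambda>m (x, y). ((a + x) ^ fst m * (b + y) ^ snd m) *\<^sub>R c (fst m) (snd m)"
        and f = "\<lambda>(x, y). f (a + x, b + y)"])
    show "0 < \<rho>" using p by (simp add: \<rho>_def)
    then show "0 < \<rho>" .
  next
    fix m :: "nat \<times> nat" and x y :: real
    obtain i j where m: "m = (i, j)" by fastforce
    show *: "((\<lambda>(k, l). (x ^ k * y ^ l) *\<^sub>R F m k l) has_sum
        (case (x, y) of (x, y) \<Rightarrow> ((a + x) ^ fst m * (b + y) ^ snd m) *\<^sub>R c (fst m) (snd m))) UNIV"
      unfolding m fst_conv snd_conv binom[symmetric] scaleR_sum_left prod.case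
    proof (rule has_sum_finite_neutralI[of "{..i} \<times> {..j}"])
      fix q assume "q \<in> UNIV - {..i} \<times> {..j}"
      from w_0[OF this] show "(case q of (k, l) \<Rightarrow> (x ^ k * y ^ l) *\<^sub>R F (i, j) k l) = 0"
        by (simp add: F case_prod_unfold)
    qed (auto simp: F intro!: sum.cong)
    show "((\<lambda>(k, l). (x ^ k * y ^ l) *\<^sub>R F m k l) has_sum
        (case (x, y) of (x, y) \<Rightarrow> ((a + x) ^ fst m * (b + y) ^ snd m) *\<^sub>R c (fst m) (snd m))) UNIV"
      by (fact *)
  next
    fix x y :: real assume "\<bar>x\<bar> < \<rho>" "\<bar>y\<bar> < \<rho>"
    then have "\<bar>a + x\<bar> < r" "\<bar>b + y\<bar> < r"
      by (auto simp: \<rho>_def)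
    from pser_has_sum[OF f this]
    show *: "((\<lambda>m. case (x, y) of (x, y) \<Rightarrow> ((a + x) ^ fst m * (b + y) ^ snd m) *\<^sub>R c (fst m) (snd m)) has_sum
        (case (x, y) of (x, y) \<Rightarrow> f (a + x, b + y))) UNIV"
      by (simp add: case_prod_unfold)
    then show "((\<lambda>m. case (x, y) of (x, y) \<Rightarrow> ((a + x) ^ fst m * (b + y) ^ snd m) *\<^sub>R c (fst m) (snd m)) has_sum
        (case (x, y) of (x, y) \<Rightarrow> f (a + x, b + y))) UNIV" .
  qed
  then show "pser (\<lambda>k l. \<Sum>\<^sub>\<infinity>m. F m k l) (r - max \<bar>a\<bar> \<bar>b\<bar>) (\<lambda>(x, y). f (a + x, b + y))"
    and "(\<lambda>m. F m k l) summable_on UNIV"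
    by (auto simp: \<rho>_def)
qed

lemma pser_imp_real_analytic_on:
  assumes "pser c r f"
  shows "real_analytic_on ({-r<..<r} \<times> {-r<..<r}) f"
  unfolding real_analytic_on_def
proof clarify
  fix a b assume "a \<in> {-r<..<r}" "b \<in> {-r<..<r}"
  then have ab: "\<bar>a\<bar> < r" "\<bar>b\<bar> < r" by auto
  from pser_shift(1)[OF assms ab] obtain d where
    d: "pser d (r - max \<bar>a\<bar> \<bar>b\<bar>) (\<lambda>(x, y). f (a + x, b + y))" by blast
  show "\<exists>r>0. \<exists>c. \<forall>x y. \<bar>x\<bar> < r \<longrightarrow> \<bar>y\<bar> < r \<longrightarrow>
      ((\<lambda>(i, j). (x ^ i * y ^ j) *\<^sub>R c i j) has_sum f (fst (a, b) + x, snd (a, b) + y)) UNIV"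
    using pser_pos[OF d] pser_has_sum[OF d] by (intro exI[of _ "r - max \<bar>a\<bar> \<bar>b\<bar>"] conjI exI[of _ d]) auto
qed

text \<open>The remainder is of second order: a term of degree \<open>n + 2\<close> is at most
  \<open>(norm h)\<^sup>2 * t ^ n\<close> times the norm of its coefficient, so all of them together
  are bounded by \<open>(norm h)\<^sup>2 / t\<^sup>2\<close> times the absolute sum at radius
  \<open>t\<close>.\<close>

lemma pser_has_derivative_0:
  assumes f: "pser d r (\<lambda>(x, y). f (a + x, b + y))"
  shows "(f has_derivative (\<lambda>h. fst h *\<^sub>R d 1 0 + snd h *\<^sub>R d 0 1)) (at (a, b))"
proof -
  define t where "t = r / 2"
  have t: "0 < t" "t < r"
    using pser_pos[OF f] by (auto simp: t_def)
  define G where "G = (\<Sum>\<^sub>\<infinity>(i, j). norm (d i j) * t ^ (i + j))"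
  have G: "((\<lambda>(i, j). norm (d i j) * t ^ (i + j)) has_sum G) UNIV"
    unfolding G_def using pser_summable[OF f] t by (intro has_sum_infsum) auto
  have f0: "f (a, b) = d 0 0"
    using pser_at_0[OF f] by simp
  have rem: "norm (f ((a, b) + h) - f (a, b) - (fst h *\<^sub>R d 1 0 + snd h *\<^sub>R d 0 1)) \<le> (norm h)\<^sup>2 * (G / t\<^sup>2)"
    if h: "norm h < t" for h
  proof -
    obtain x y where xy: "h = (x, y)" by fastforce
    have le: "\<bar>x\<bar> \<le> norm h" "\<bar>y\<bar> \<le> norm h"
      using norm_fst_le[of x y] norm_snd_le[of y x] by (auto simp: xy)
    define T where "T = (\<lambda>i j. (x ^ i * y ^ j) *\<^sub>R d i j)"
    have T1: "((\<lambda>(i, j). T i j) has_sum f (a + x, b + y)) UNIV"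
      using pser_has_sum[OF f, of x y] le h t by (simp add: T_def)
    have T2: "((\<lambda>(i, j). if i + j < 2 then T i j else 0) has_sum (T 0 0 + T 1 0 + T 0 1)) UNIV"
      by (rule has_sum_finite_neutralI[of "{(0, 0), (1, 0), (0, 1)}"]) (auto split: if_splits)
    have T2': "((\<lambda>(i, j). if i + j < 2 then T i j else 0) has_sum - (- (T 0 0 + T 1 0 + T 0 1))) UNIV"
      unfolding minus_minus by (rule T2)
    from has_sum_add[OF T1 has_sum_uminus[THEN iffD2, OF T2']]
    have R: "((\<lambda>(i, j). if i + j < 2 then 0 else T i j)
        has_sum (f ((a, b) + h) - f (a, b) - (fst h *\<^sub>R d 1 0 + snd h *\<^sub>R d 0 1))) UNIV"
      by (rule has_sum_cong[THEN iffD1, rotated, THEN back_subst[of "\<lambda>S. (_ has_sum S) _"]])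
        (auto simp: T_def f0 xy)
    show ?thesis
    proof (rule norm_infsum_le[OF R])
      show "((\<lambda>p. (norm h)\<^sup>2 / t\<^sup>2 * (case p of (i, j) \<Rightarrow> norm (d i j) * t ^ (i + j))) has_sum
          (norm h)\<^sup>2 * (G / t\<^sup>2)) UNIV"
        using has_sum_cmult_right[OF G, of "(norm h)\<^sup>2 / t\<^sup>2"] by simp
      fix p :: "nat \<times> nat"
      obtain i j where p: "p = (i, j)" by fastforce
      show "norm (case p of (i, j) \<Rightarrow> if i + j < 2 then 0 else T i j)
          \<le> (norm h)\<^sup>2 / t\<^sup>2 * (case p of (i, j) \<Rightarrow> norm (d i j) * t ^ (i + j))"
      proof (cases "i + j < 2")
        case False
        then obtain n where n: "i + j = n + 2"
          by (metis le_add_diff_inverse2 not_less)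
        have "norm (T i j) \<le> norm h ^ (n + 2) * norm (d i j)"
          unfolding T_def norm_scaleR n[symmetric]
          by (intro mult_right_mono) (use power_prod_le[OF le] in auto)
        also have "\<dots> \<le> (norm h)\<^sup>2 * t ^ n * norm (d i j)"
          unfolding power_add using h
          by (subst mult.commute[of "norm h ^ n"]) (intro mult_right_mono mult_left_mono power_mono; simp)
        also have "\<dots> = (norm h)\<^sup>2 / t\<^sup>2 * (norm (d i j) * t ^ (i + j))"
          using t by (simp add: n power_add power2_eq_square)
        finally show ?thesis using False by (simp add: p)
      qed (use t in \<open>simp add: p\<close>)
    qed
  qed
  show ?thesis
    unfolding has_derivative_at
  proof
    show "bounded_linear (\<lambda>h. fst h *\<^sub>R d 1 0 + snd h *\<^sub>R d 0 1)"
      by (intro bounded_linear_add bounded_linear_scaleR_const bounded_linear_fst bounded_linear_snd)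
    have "((\<lambda>h :: real \<times> real. norm h * (G / t\<^sup>2)) \<longlongrightarrow> 0) (at 0)"
      by (intro tendsto_mult_left_zero tendsto_norm_zero tendsto_ident_at)
    moreover have "\<forall>\<^sub>F h in at 0. norm (norm (f ((a, b) + h) - f (a, b) - (fst h *\<^sub>R d 1 0 + snd h *\<^sub>R d 0 1))
        / norm h) \<le> norm h * (G / t\<^sup>2)"
      unfolding eventually_at
    proof (intro exI[of _ t] conjI ballI impI t)
      fix h :: "real \<times> real" assume "h \<noteq> 0 \<and> dist h 0 < t"
      then show "norm (norm (f ((a, b) + h) - f (a, b) - (fst h *\<^sub>R d 1 0 + snd h *\<^sub>R d 0 1))
        / norm h) \<le> norm h * (G / t\<^sup>2)"
        using rem[of h] by (simp add: divide_le_eq power2_eq_square mult_ac)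
    qed
    ultimately show "(\<lambda>h. norm (f ((a, b) + h) - f (a, b) - (fst h *\<^sub>R d 1 0 + snd h *\<^sub>R d 0 1)) / norm h) \<midarrow>0\<rightarrow> 0"
      by (rule Lim_null_comparison[rotated])
  qed
qed

section \<open>Partial derivatives and termwise differentiation\<close>

lemma
  assumes "(f has_derivative f') (at p)"
  shows pdx_eq: "pdx f p = f' (1, 0)" and pdy_eq: "pdy f p = f' (0, 1)"
proof -
  interpret f': bounded_linear f'
    using assms by (rule has_derivative_bounded_linear)
  have "((\<lambda>t. f (t, snd p)) has_derivative (\<lambda>t. f' (t, 0))) (at (fst p))"
    by (rule has_derivative_compose[of "\<lambda>t. (t, snd p)"])
      (use assms in \<open>auto intro!: derivative_eq_intros\<close>)
  moreover have "(\<lambda>t. f' (t, 0)) = (\<lambda>t. t *\<^sub>R f' (1, 0))"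
    by (simp flip: f'.scaleR)
  ultimately show "pdx f p = f' (1, 0)"
    unfolding pdx_def by (intro vector_derivative_at) (simp add: has_vector_derivative_def)
  have "((\<lambda>t. f (fst p, t)) has_derivative (\<lambda>t. f' (0, t))) (at (snd p))"
    by (rule has_derivative_compose[of "\<lambda>t. (fst p, t)"])
      (use assms in \<open>auto intro!: derivative_eq_intros\<close>)
  moreover have "(\<lambda>t. f' (0, t)) = (\<lambda>t. t *\<^sub>R f' (0, 1))"
    by (simp flip: f'.scaleR)
  ultimately show "pdy f p = f' (0, 1)"
    unfolding pdy_def by (intro vector_derivative_at) (simp add: has_vector_derivative_def)
qed

lemma has_derivative_pd:
  assumes "f differentiable (at p)"
  shows "(f has_derivative (\<lambda>h. fst h *\<^sub>R pdx f p + snd h *\<^sub>R pdy f p)) (at p)"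
proof -
  obtain f' where f': "(f has_derivative f') (at p)"
    using assms by (auto simp: differentiable_def)
  interpret f': bounded_linear f'
    using f' by (rule has_derivative_bounded_linear)
  have "f' h = fst h *\<^sub>R pdx f p + snd h *\<^sub>R pdy f p" for h
    unfolding pdx_eq[OF f'] pdy_eq[OF f'] by (simp flip: f'.scaleR f'.add)
  then have "f' = (\<lambda>h. fst h *\<^sub>R pdx f p + snd h *\<^sub>R pdy f p)" by auto
  with f' show ?thesis by simp
qed

lemma pser_differentiable:
  assumes "pser c r f" "\<bar>a\<bar> < r" "\<bar>b\<bar> < r"
  shows "f differentiable (at (a, b))"
  using pser_has_derivative_0[OF pser_shift(1)[OF assms]] unfolding differentiable_def by blast

lemma has_sum_Suc_index:
  fixes f :: "nat \<Rightarrow> nat \<Rightarrow> 'b::{comm_monoid_add, topological_space}"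
  assumes "((\<lambda>(i, j). f i j) has_sum S) UNIV"
  shows "(\<And>j. f 0 j = 0) \<Longrightarrow> ((\<lambda>(i, j). f (Suc i) j) has_sum S) UNIV"
    and "(\<And>i. f i 0 = 0) \<Longrightarrow> ((\<lambda>(i, j). f i (Suc j)) has_sum S) UNIV"
proof -
  assume "\<And>j. f 0 j = 0"
  then have "((\<lambda>(i, j). f i j) has_sum S) {(i, j). i \<noteq> 0}"
    by (intro has_sum_cong_neutral[THEN iffD1, OF _ _ _ assms]) auto
  then show "((\<lambda>(i, j). f (Suc i) j) has_sum S) UNIV"
    by (subst has_sum_reindex_bij_witness[where T = "{(i, j). i \<noteq> 0}"
          and i = "\<lambda>(i, j). (i - 1, j)" and j = "\<lambda>(i, j). (Suc i, j)"
          and h = "\<lambda>(i, j). f i j" and s' = S]) auto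
next
  assume "\<And>i. f i 0 = 0"
  then have "((\<lambda>(i, j). f i j) has_sum S) {(i, j). j \<noteq> 0}"
    by (intro has_sum_cong_neutral[THEN iffD1, OF _ _ _ assms]) auto
  then show "((\<lambda>(i, j). f i (Suc j)) has_sum S) UNIV"
    by (subst has_sum_reindex_bij_witness[where T = "{(i, j). j \<noteq> 0}"
          and i = "\<lambda>(i, j). (i, j - 1)" and j = "\<lambda>(i, j). (i, Suc j)"
          and h = "\<lambda>(i, j). f i j" and s' = S]) auto
qed

text \<open>The derivative at \<open>(a, b)\<close> is read off from the first-order coefficients of
  the re-expansion there, which are sums over the old coefficients. No uniform convergence is
  involved.\<close>

lemma pser_has_sum_pd:
  assumes f: "pser c r f" and ab: "\<bar>a\<bar> < r" "\<bar>b\<bar> < r"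
  shows "((\<lambda>(i, j). (a ^ i * b ^ j) *\<^sub>R (real (Suc i) *\<^sub>R c (Suc i) j)) has_sum pdx f (a, b)) UNIV"
    and "((\<lambda>(i, j). (a ^ i * b ^ j) *\<^sub>R (real (Suc j) *\<^sub>R c i (Suc j))) has_sum pdy f (a, b)) UNIV"
proof -
  define F where "F = (\<lambda>(i, j) k l. (real (i choose k) * real (j choose l) * a ^ (i - k) * b ^ (j - l)) *\<^sub>R c i j)"
  note shift = pser_shift[OF f ab, folded F_def]
  note D = pser_has_derivative_0[OF shift(1)]
  have "((\<lambda>m. F m 1 0) has_sum pdx f (a, b)) UNIV" "((\<lambda>m. F m 0 1) has_sum pdy f (a, b)) UNIV"
    unfolding pdx_eq[OF D] pdy_eq[OF D] using has_sum_infsum[OF shift(2)] by simp_all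
  then have "((\<lambda>(i, j). (real i * a ^ (i - 1) * b ^ j) *\<^sub>R c i j) has_sum pdx f (a, b)) UNIV"
      "((\<lambda>(i, j). (a ^ i * (real j * b ^ (j - 1))) *\<^sub>R c i j) has_sum pdy f (a, b)) UNIV"
    by (simp_all add: F_def case_prod_unfold mult_ac)
  from this(1)[THEN has_sum_Suc_index(1)] this(2)[THEN has_sum_Suc_index(2)]
  show "((\<lambda>(i, j). (a ^ i * b ^ j) *\<^sub>R (real (Suc i) *\<^sub>R c (Suc i) j)) has_sum pdx f (a, b)) UNIV"
    and "((\<lambda>(i, j). (a ^ i * b ^ j) *\<^sub>R (real (Suc j) *\<^sub>R c i (Suc j))) has_sum pdy f (a, b)) UNIV"
    by (simp_all add: mult_ac del: of_nat_Suc)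
qed

lemma
  assumes f: "pser c r f"
  shows pser_pdx: "pser (\<lambda>i j. real (Suc i) *\<^sub>R c (Suc i) j) r (pdx f)"
    and pser_pdy: "pser (\<lambda>i j. real (Suc j) *\<^sub>R c i (Suc j)) r (pdy f)"
proof -
  have *: "(\<lambda>(i, j). norm (real (Suc i) *\<^sub>R c (Suc i) j) * s ^ (i + j)) summable_on UNIV"
      "(\<lambda>(i, j). norm (real (Suc j) *\<^sub>R c i (Suc j)) * s ^ (i + j)) summable_on UNIV"
    if s: "0 \<le> s" "s < r" for s
  proof -
    have "\<bar>s\<bar> < r" using s by simp
    \<comment> \<open>The series of norms, differentiated at \<open>(s, s)\<close>, consists of the
      norms of the differentiated series.\<close>
    note * = pser_has_sum_pd[OF pser_norm[OF f] this this, THEN has_sum_imp_summable]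
    show "(\<lambda>(i, j). norm (real (Suc i) *\<^sub>R c (Suc i) j) * s ^ (i + j)) summable_on UNIV"
      by (rule summable_on_cong[THEN iffD1, OF _ *(1)]) (auto simp: power_add)
    show "(\<lambda>(i, j). norm (real (Suc j) *\<^sub>R c i (Suc j)) * s ^ (i + j)) summable_on UNIV"
      by (rule summable_on_cong[THEN iffD1, OF _ *(2)]) (auto simp: power_add)
  qed
  show "pser (\<lambda>i j. real (Suc i) *\<^sub>R c (Suc i) j) r (pdx f)"
    by (rule pserI[OF pser_pos[OF f] *(1) pser_has_sum_pd(1)[OF f]])
  show "pser (\<lambda>i j. real (Suc j) *\<^sub>R c i (Suc j)) r (pdy f)"
    by (rule pserI[OF pser_pos[OF f] *(2) pser_has_sum_pd(2)[OF f]])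
qed

text \<open>Partial derivatives are series on the same square, so the induction loses no
  radius.\<close>

lemma pser_Ck_on: "pser c r f \<Longrightarrow> Ck_on k ({-r<..<r} \<times> {-r<..<r}) f"
proof (induction k arbitrary: c f)
  case (Suc k)
  have diff: "f differentiable (at p)" if "p \<in> {-r<..<r} \<times> {-r<..<r}" for p
    using that pser_differentiable[OF Suc.prems, of "fst p" "snd p"] by auto
  have "f differentiable_on ({-r<..<r} \<times> {-r<..<r})"
    unfolding differentiable_on_def by (rule ballI, rule differentiable_at_withinI, rule diff)
  with Suc.IH[OF pser_pdx[OF Suc.prems]] Suc.IH[OF pser_pdy[OF Suc.prems]] show ?case
    by simp
next
  case 0
  have "continuous (at p) f" if "p \<in> {-r<..<r} \<times> {-r<..<r}" for p
    using that pser_differentiable[OF 0, of "fst p" "snd p"]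
    by (intro differentiable_imp_continuous_within) auto
  then show ?case
    by (simp add: continuous_at_imp_continuous_on)
qed

lemma pser_smooth_on: "pser c r f \<Longrightarrow> smooth_on ({-r<..<r} \<times> {-r<..<r}) f"
  unfolding smooth_on_def by (blast intro: pser_Ck_on)

lemma pser_pdx_funpow:
  "pser c r f \<Longrightarrow> pser (\<lambda>i j. (fact (i + m) / fact i) *\<^sub>R c (i + m) j) r ((pdx ^^ m) f)"
proof (induction m)
  case (Suc m)
  from pser_pdx[OF Suc.IH[OF Suc.prems]] show ?case
    by (simp add: divide_simps mult_ac)
qed simp

lemma pser_pdy_funpow:
  "pser c r f \<Longrightarrow> pser (\<lambda>i j. (fact (j + m) / fact j) *\<^sub>R c i (j + m)) r ((pdy ^^ m) f)"
proof (induction m)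
  case (Suc m)
  from pser_pdy[OF Suc.IH[OF Suc.prems]] show ?case
    by (simp add: divide_simps mult_ac)
qed simp

lemma pser_jet:
  assumes "pser c r f"
  shows "jet n f x y = (\<Sum>k=0..n. \<Sum>i=0..k. c (k - i) i * x ^ (k - i) * y ^ i)"
  unfolding jet_def pser_at_0[OF pser_pdx_funpow[OF pser_pdy_funpow[OF assms]]] by simp

lemma pser_of_bound:
  fixes c :: "nat \<Rightarrow> nat \<Rightarrow> 'b::banach"
  assumes "M > 0" and c: "\<And>i j. norm (c i j) \<le> M ^ (i + j)"
  shows "pser c (1 / M) (\<lambda>(x, y). \<Sum>\<^sub>\<infinity>(i, j). (x ^ i * y ^ j) *\<^sub>R c i j)"
proof (rule pserI)
  show summ: "(\<lambda>(i, j). norm (c i j) * s ^ (i + j)) summable_on UNIV" if s: "0 \<le> s" "s < 1 / M" for s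
  proof -
    define t where "t = M * s"
    have t: "0 \<le> t" "t < 1"
      using s \<open>M > 0\<close> by (auto simp: t_def field_simps)
    have geo: "((\<lambda>n. t ^ n) has_sum (1 / (1 - t))) UNIV"
      using t geometric_sums[of t] by (intro sums_nonneg_imp_has_sum) auto
    have "(\<lambda>(i, j). t ^ i * t ^ j) summable_on UNIV \<times> UNIV"
    proof (rule summable_on_SigmaI)
      show "((\<lambda>j. case (i, j) of (i, j) \<Rightarrow> t ^ i * t ^ j) has_sum t ^ i * (1 / (1 - t))) UNIV" for i
        using has_sum_cmult_right[OF geo] by simp
      show "(\<lambda>i. t ^ i * (1 / (1 - t))) summable_on UNIV"
        by (rule has_sum_imp_summable[OF has_sum_cmult_left[OF geo]])
    qed (use t in auto)
    then have "(\<lambda>(i, j). t ^ i * t ^ j) summable_on UNIV"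
      by simp
    then show ?thesis
    proof (rule summable_on_comparison_test)
      fix q :: "nat \<times> nat"
      obtain i j where q: "q = (i, j)" by fastforce
      have "norm (c i j) * s ^ (i + j) \<le> M ^ (i + j) * s ^ (i + j)"
        using s c by (intro mult_right_mono) auto
      then show "(case q of (i, j) \<Rightarrow> norm (c i j) * s ^ (i + j)) \<le> (case q of (i, j) \<Rightarrow> t ^ i * t ^ j)"
        by (simp add: q t_def power_mult_distrib power_add mult_ac)
    qed (use s in auto)
  qed
  fix x y :: real assume xy: "\<bar>x\<bar> < 1 / M" "\<bar>y\<bar> < 1 / M"
  define s where "s = max \<bar>x\<bar> \<bar>y\<bar>"
  have s: "0 \<le> s" "s < 1 / M" "\<bar>x\<bar> \<le> s" "\<bar>y\<bar> \<le> s"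
    using xy by (auto simp: s_def)
  have "(\<lambda>q. norm (case q of (i, j) \<Rightarrow> (x ^ i * y ^ j) *\<^sub>R c i j)) summable_on UNIV"
    by (rule summable_on_comparison_test[OF summ[OF s(1,2)]])
      (auto simp: mult.commute[of "norm _"] intro!: mult_right_mono power_prod_le[OF s(3,4)])
  then show "((\<lambda>(i, j). (x ^ i * y ^ j) *\<^sub>R c i j) has_sum
      (case (x, y) of (x, y) \<Rightarrow> \<Sum>\<^sub>\<infinity>(i, j). (x ^ i * y ^ j) *\<^sub>R c i j)) UNIV"
    by (auto simp: abs_summable_summable intro!: has_sum_infsum)
qed (use \<open>M > 0\<close> in auto)

section \<open>Euler operators and removal of coordinate factors\<close>

lemma pser_monomial_mult:
  fixes f :: "real \<times> real \<Rightarrow> real"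
  assumes "pser c r f"
  shows "pser (\<lambda>i j. if k \<le> i \<and> l \<le> j then c (i - k) (j - l) else 0) r (\<lambda>p. fst p ^ k * snd p ^ l * f p)"
proof (rule pserI)
  fix s :: real assume s: "0 \<le> s" "s < r"
  have "(\<lambda>(i, j). s ^ (k + l) * (norm (c i j) * s ^ (i + j))) summable_on UNIV"
    using summable_on_cmult_right[OF pser_summable[OF assms s]] by (simp add: case_prod_unfold)
  from summable_shift_index[OF this, of k l]
  show "(\<lambda>(i, j). norm (if k \<le> i \<and> l \<le> j then c (i - k) (j - l) else 0) * s ^ (i + j)) summable_on UNIV"
    by (rule summable_on_cong[THEN iffD1, rotated]) (auto simp: le_iff_add power_add)
next
  fix x y :: real assume xy: "\<bar>x\<bar> < r" "\<bar>y\<bar> < r"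
  have "((\<lambda>(i, j). (x ^ k * y ^ l) * ((x ^ i * y ^ j) *\<^sub>R c i j)) has_sum (x ^ k * y ^ l) * f (x, y)) UNIV"
    using has_sum_cmult_right[OF pser_has_sum[OF assms xy], of "x ^ k * y ^ l"] by (simp add: case_prod_unfold)
  from has_sum_shift_index[OF this, of k l]
  show "((\<lambda>(i, j). (x ^ i * y ^ j) *\<^sub>R (if k \<le> i \<and> l \<le> j then c (i - k) (j - l) else 0)) has_sum
      fst (x, y) ^ k * snd (x, y) ^ l * f (x, y)) UNIV"
    unfolding fst_conv snd_conv
    by (rule has_sum_cong[THEN iffD1, rotated]) (auto simp: le_iff_add power_add)
qed (use pser_pos assms in blast)

lemma pser_unique:
  assumes "pser c r f" "pser c r g" "\<bar>x\<bar> < r" "\<bar>y\<bar> < r"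
  shows "f (x, y) = g (x, y)"
  using has_sum_unique[OF pser_has_sum[OF assms(1,3,4)] pser_has_sum[OF assms(2,3,4)]] .

text \<open>Multiplying by the coordinate undoes the index shift of differentiation, so the
  coefficients are merely scaled; the guard of the shifted series is absorbed by the factor
  \<open>real i\<close> or \<open>real j\<close>, which is zero where the guard fails.\<close>

lemma
  fixes f :: "real \<times> real \<Rightarrow> real"
  assumes f: "pser c r f"
  shows pser_euler_x: "pser (\<lambda>i j. real i * c i j) r (\<lambda>p. fst p * pdx f p)"
    and pser_euler_y: "pser (\<lambda>i j. real j * c i j) r (\<lambda>p. snd p * pdy f p)"
    and pser_euler_xy: "pser (\<lambda>i j. real i * real j * c i j) r (\<lambda>p. fst p * snd p * pdy (pdx f) p)"
proof -
  have "(\<lambda>i j. if 1 \<le> i \<and> 0 \<le> j then real (Suc (i - 1)) *\<^sub>R c (Suc (i - 1)) (j - 0) else 0) = (\<lambda>i j. real i * c i j)"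
    by (auto simp: fun_eq_iff)
  with pser_monomial_mult[OF pser_pdx[OF f], of 1 0]
  show "pser (\<lambda>i j. real i * c i j) r (\<lambda>p. fst p * pdx f p)" by simp
  have "(\<lambda>i j. if 0 \<le> i \<and> 1 \<le> j then real (Suc (j - 1)) *\<^sub>R c (i - 0) (Suc (j - 1)) else 0) = (\<lambda>i j. real j * c i j)"
    by (auto simp: fun_eq_iff)
  with pser_monomial_mult[OF pser_pdy[OF f], of 0 1]
  show "pser (\<lambda>i j. real j * c i j) r (\<lambda>p. snd p * pdy f p)" by simp
  have "(\<lambda>i j. if 1 \<le> i \<and> 1 \<le> j then real (Suc (j - 1)) *\<^sub>R real (Suc (i - 1)) *\<^sub>R c (Suc (i - 1)) (Suc (j - 1)) else 0)
      = (\<lambda>i j. real i * real j * c i j)"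
    by (auto simp: fun_eq_iff)
  with pser_monomial_mult[OF pser_pdy[OF pser_pdx[OF f]], of 1 1]
  show "pser (\<lambda>i j. real i * real j * c i j) r (\<lambda>p. fst p * snd p * pdy (pdx f) p)" by simp
qed

text \<open>A nonzero value would persist on a ball, but a point on an axis can be moved off it, by
  \<open>t\<close> in each vanishing coordinate, without leaving the ball or the square.\<close>

lemma pser_eq_0:
  fixes f :: "real \<times> real \<Rightarrow> 'b::banach"
  assumes f: "pser c r f"
    and 0: "\<And>x y. \<bar>x\<bar> < r \<Longrightarrow> \<bar>y\<bar> < r \<Longrightarrow> x \<noteq> 0 \<Longrightarrow> y \<noteq> 0 \<Longrightarrow> f (x, y) = 0"
    and ab: "\<bar>a\<bar> < r" "\<bar>b\<bar> < r"
  shows "f (a, b) = 0"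
proof (rule ccontr)
  assume nz: "f (a, b) \<noteq> 0"
  have "isCont f (a, b)"
    by (rule differentiable_imp_continuous_within[OF pser_differentiable[OF f ab]])
  from continuous_at_avoid[OF this nz]
  obtain e where e: "e > 0" "\<And>p. dist (a, b) p < e \<Longrightarrow> f p \<noteq> 0" by blast
  define t where "t = min (r / 2) (e / 3)"
  have t: "0 < t" "t < r" "t < e / 2"
    using e(1) pser_pos[OF f] by (auto simp: t_def)
  define x where "x = (if a = 0 then t else a)"
  define y where "y = (if b = 0 then t else b)"
  have "f (x, y) = 0"
    using t ab by (intro 0) (auto simp: x_def y_def)
  moreover have "dist (a, b) (x, y) \<le> dist a x + dist b y"
    unfolding dist_prod_def by (simp add: sqrt_sum_squares_le_sum)
  then have "dist (a, b) (x, y) < e"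
    using t by (auto simp: x_def y_def dist_real_def split: if_splits)
  ultimately show False
    using e(2) by blast
qed

subsection \<open>The forced coefficients\<close>

text \<open>\<open>splittings\<close> with the exponent \<open>(0, 0)\<close> readmitted, so that
  sums over it are threefold convolutions.\<close>

definition triples :: "nat \<Rightarrow> nat \<Rightarrow> (nat \<times> nat \<times> nat \<times> nat \<times> nat \<times> nat) set" where
  "triples p q = {(i1, j1, i2, j2, i3, j3). i1 + i2 + i3 = p \<and> j1 + j2 + j3 = q}"

lemma finite_triples: "finite (triples p q)"
  by (rule finite_subset[of _ "{..p} \<times> {..q} \<times> {..p} \<times> {..q} \<times> {..p} \<times> {..q}"])
    (auto simp: triples_def)

lemma splittings_subset_triples: "splittings p q \<subseteq> triples p q"
  by (auto simp: splittings_def triples_def)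

lemma sum_triples:
  "(\<Sum>(i1, j1, i2, j2, i3, j3)\<in>triples p q. f i1 j1 * g i2 j2 * h i3 j3) = conv f (conv g h) p q"
proof -
  have "(\<Sum>(i1, j1, i2, j2, i3, j3)\<in>triples p q. f i1 j1 * g i2 j2 * h i3 j3) =
      (\<Sum>((i, j), (k, l))\<in>Sigma ({..p} \<times> {..q}) (\<lambda>(i, j). {..p - i} \<times> {..q - j}).
        f i j * (g k l * h (p - i - k) (q - j - l)))"
    by (rule sum.reindex_bij_witness[where j = "\<lambda>(i1, j1, i2, j2, i3, j3). ((i1, j1), (i2, j2))"
          and i = "\<lambda>((i, j), (k, l)). (i, j, k, l, p - i - k, q - j - l)"])
      (auto simp: triples_def mult_ac)
  also have "\<dots> = conv f (conv g h) p q"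
    unfolding conv_def
    by (subst sum.Sigma[symmetric]) (auto simp: sum.cartesian_product sum_distrib_left case_prod_unfold)
  finally show ?thesis .
qed

text \<open>The excluded exponents may return because \<open>forced_coef\<close> is zero at
  \<open>(0, 0)\<close>. Once \<open>p q\<close> is cleared, the identity also holds on the axes:
  every term contains an exponent of \<open>x\<close> and an exponent of \<open>y\<close>, one of
  which is then zero.\<close>

lemma forced_coef_sum_triples:
  fixes a b :: "nat \<Rightarrow> nat \<Rightarrow> real"
  defines "u \<equiv> forced_coef a b" and "v \<equiv> forced_coef b a"
  shows "real p * real q * u p q = (\<Sum>(i1, j1, i2, j2, i3, j3)\<in>triples p q.
      2 * real i2 * real j3 * u i1 j1 * u i2 j2 * u i3 j3
    + real i2 * real j3 * v i1 j1 * u i2 j2 * v i3 j3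
    + real j2 * real i3 * v i1 j1 * u i2 j2 * v i3 j3
    - real i3 * real j3 * (u i1 j1 * u i2 j2 + v i1 j1 * v i2 j2) * u i3 j3)" (is "_ = sum ?f _")
proof (cases "p = 0 \<or> q = 0")
  case True
  then have "sum ?f (triples p q) = 0"
    by (intro sum.neutral) (auto simp: triples_def)
  then show ?thesis using True by auto
next
  case False
  have [simp]: "u 0 0 = 0" "v 0 0 = 0"
    by (simp_all add: u_def v_def forced_coef_axes)
  have "real p * real q * u p q = sum ?f (splittings p q)"
    unfolding u_def v_def using False by (subst forced_coef.simps) simp
  also have "\<dots> = sum ?f (triples p q)"
  proof (rule sum.mono_neutral_left[OF finite_triples splittings_subset_triples], rule ballI)
    fix t assume "t \<in> triples p q - splittings p q"
    then obtain i1 j1 i2 j2 i3 j3 where t: "t = (i1, j1, i2, j2, i3, j3)"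
        and "(i1, j1) = (0, 0) \<or> (i2, j2) = (0, 0) \<or> (i3, j3) = (0, 0)"
      unfolding triples_def splittings_def by blast
    from this(2) show "?f t = 0"
      unfolding t by (elim disjE) simp_all
  qed
  finally show ?thesis .
qed

text \<open>Differences are written as \<open>+ -\<close> so that the closure rules for sums,
  products and linear maps reproduce the right side verbatim.\<close>

lemma forced_coef_conv:
  fixes a b :: "nat \<Rightarrow> nat \<Rightarrow> real"
  defines "u \<equiv> forced_coef a b" and "v \<equiv> forced_coef b a"
  shows "(\<lambda>p q. real p * real q * u p q) = (\<lambda>p q.
    2 * conv u (conv (\<lambda>i j. real i * u i j) (\<lambda>i j. real j * u i j)) p q
    + conv v (conv (\<lambda>i j. real i * u i j) (\<lambda>i j. real j * v i j)) p q
    + conv v (conv (\<lambda>i j. real j * u i j) (\<lambda>i j. real i * v i j)) p q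
    + - conv u (conv u (\<lambda>i j. real i * real j * u i j)) p q
    + - conv v (conv v (\<lambda>i j. real i * real j * u i j)) p q)"
proof (intro ext)
  fix p q
  show "real p * real q * u p q =
    2 * conv u (conv (\<lambda>i j. real i * u i j) (\<lambda>i j. real j * u i j)) p q
    + conv v (conv (\<lambda>i j. real i * u i j) (\<lambda>i j. real j * v i j)) p q
    + conv v (conv (\<lambda>i j. real j * u i j) (\<lambda>i j. real i * v i j)) p q
    + - conv u (conv u (\<lambda>i j. real i * real j * u i j)) p q
    + - conv v (conv v (\<lambda>i j. real i * real j * u i j)) p q"
    unfolding forced_coef_sum_triples[of p q a b, folded u_def v_def] sum_triples[symmetric]
      sum_distrib_left sum_negf[symmetric] sum.distrib[symmetric]
    by (rule sum.cong[OF refl]) (simp add: case_prod_unfold algebra_simps)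
qed

lemma forced_coef_pde:
  fixes a b :: "nat \<Rightarrow> nat \<Rightarrow> real"
  assumes u: "pser (forced_coef a b) r u" and v: "pser (forced_coef b a) r v"
    and xy: "\<bar>x\<bar> < r" "\<bar>y\<bar> < r"
  defines "p \<equiv> (x, y)"
  shows "pdy (pdx u) p * (1 + (u p)\<^sup>2 + (v p)\<^sup>2) =
    2 * u p * pdx u p * pdy u p + v p * (pdx u p * pdy v p + pdy u p * pdx v p)"
proof -
  define E where "E = (\<lambda>p. pdy (pdx u) p * (1 + (u p)\<^sup>2 + (v p)\<^sup>2) -
    (2 * u p * pdx u p * pdy u p + v p * (pdx u p * pdy v p + pdy u p * pdx v p)))"
  \<comment> \<open>The system solved for the mixed derivative and multiplied by \<open>x y\<close>,
    each derivative being paired with its own coordinate to form an Euler operator.\<close>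
  define R where "R = (\<lambda>p. 2 * (u p * ((fst p * pdx u p) * (snd p * pdy u p)))
    + v p * ((fst p * pdx u p) * (snd p * pdy v p))
    + v p * ((snd p * pdy u p) * (fst p * pdx v p))
    + - (u p * (u p * (fst p * snd p * pdy (pdx u) p)))
    + - (v p * (v p * (fst p * snd p * pdy (pdx u) p))))"
  note eu = pser_euler_x[OF u] pser_euler_y[OF u] pser_euler_xy[OF u]
  note ev = pser_euler_x[OF v] pser_euler_y[OF v]
  have "pser (\<lambda>i j. real i * real j * forced_coef a b i j) r R"
    unfolding R_def
    by (subst forced_coef_conv) (intro pser_add pser_bounded_linear[OF _ bounded_linear_mult_right]
        pser_bounded_linear[OF _ bounded_linear_minus[OF bounded_linear_ident]] pser_mult u v eu ev)
  from pser_unique[OF eu(3) this]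
  have "fst p * snd p * E p = 0" if "\<bar>fst p\<bar> < r" "\<bar>snd p\<bar> < r" for p
    using that by (cases p) (simp add: E_def R_def algebra_simps power2_eq_square)
  then have E0: "E (x, y) = 0" if "\<bar>x\<bar> < r" "\<bar>y\<bar> < r" "x \<noteq> 0" "y \<noteq> 0" for x y
    using that by (metis fst_conv mult_eq_0_iff snd_conv)
  have E_eq: "E = (\<lambda>p. pdy (pdx u) p * (1 + (u p * u p + v p * v p)) +
      - (2 * (u p * (pdx u p * pdy u p)) + v p * (pdx u p * pdy v p + pdy u p * pdx v p)))"
    by (simp add: E_def algebra_simps power2_eq_square)
  \<comment> \<open>The coefficients of \<open>E\<close> are irrelevant: some expansion is enough
    for the continuity that carries \<open>E = 0\<close> onto the axes.\<close>
  have "\<exists>e. pser e r E"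
    unfolding E_eq
    by (rule exI, (rule u v pser_pdx[OF u] pser_pdx[OF v] pser_pdy[OF u] pser_pdy[OF v]
        pser_pdy[OF pser_pdx[OF u]] pser_const[OF pser_pos[OF u]] pser_add
        pser_bounded_linear[OF _ bounded_linear_mult_right]
        pser_bounded_linear[OF _ bounded_linear_minus[OF bounded_linear_ident]] pser_mult)+)
  then obtain e where "pser e r E" ..
  from pser_eq_0[OF this E0 xy] show ?thesis
    by (simp add: E_def p_def)
qed


subsection \<open>Convergence\<close>

definition wt :: "nat \<Rightarrow> real" where
  "wt i = 1 / (1 + real i)\<^sup>2"

lemma wt_pos: "wt i > 0"
  by (simp add: wt_def)

lemma wt_le_1: "wt i \<le> 1"
  by (simp add: wt_def)

text \<open>Telescoping; the subtracted term makes the induction close.\<close>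

lemma sum_wt_le: "(\<Sum>i\<le>p. wt i) \<le> 2 - 1 / (1 + real p)"
proof (induction p)
  case (Suc p)
  have "wt (Suc p) \<le> 1 / (1 + real p) - 1 / (1 + real (Suc p))"
    by (simp add: wt_def divide_simps power2_eq_square)
  with Suc show ?case by simp
qed (simp add: wt_def)

text \<open>From \<open>(x + y)\<^sup>2 \<le> 2 * (x\<^sup>2 + y\<^sup>2)\<close>, a product of two
  weights is at most \<open>2 * wt p\<close> times their sum. Each of the two resulting sums of
  weights is at most \<open>2\<close>, which gives the \<open>8\<close>.\<close>

lemma sum_wt_mult_le: "(\<Sum>i\<le>p. wt i * wt (p - i)) \<le> 8 * wt p"
proof -
  have "wt i * wt (p - i) \<le> 2 * wt p * (wt i + wt (p - i))" if "i \<le> p" for i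
  proof -
    define x y where "x = 1 + real i" and "y = 1 + real (p - i)"
    have xy: "x > 0" "y > 0" "1 + real p \<le> x + y"
      using that by (auto simp: x_def y_def of_nat_diff)
    have "(1 + real p)\<^sup>2 \<le> (x + y)\<^sup>2"
      using xy by (intro power_mono) auto
    also have "\<dots> \<le> 2 * (x\<^sup>2 + y\<^sup>2)"
      using sum_squares_bound[of x y] by (simp add: power2_sum)
    finally have "(1 + real p)\<^sup>2 * (1 / (x\<^sup>2 * y\<^sup>2)) \<le> 2 * (x\<^sup>2 + y\<^sup>2) * (1 / (x\<^sup>2 * y\<^sup>2))"
      by (intro mult_right_mono) auto
    also have "\<dots> = 2 * (1 / x\<^sup>2 + 1 / y\<^sup>2)"
      using xy by (simp add: field_simps)
    finally have "1 / (x\<^sup>2 * y\<^sup>2) \<le> 2 * (1 / x\<^sup>2 + 1 / y\<^sup>2) / (1 + real p)\<^sup>2"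
      by (subst pos_le_divide_eq) (auto simp: mult.commute)
    then show ?thesis
      by (simp add: wt_def x_def y_def)
  qed
  then have "(\<Sum>i\<le>p. wt i * wt (p - i)) \<le> (\<Sum>i\<le>p. 2 * wt p * (wt i + wt (p - i)))"
    by (intro sum_mono) auto
  also have "\<dots> = 2 * wt p * ((\<Sum>i\<le>p. wt i) + (\<Sum>i\<le>p. wt (p - i)))"
    by (simp add: sum.distrib flip: sum_distrib_left)
  also have "(\<Sum>i\<le>p. wt (p - i)) = (\<Sum>i\<le>p. wt i)"
    by (rule sum.reindex_bij_witness[of _ "\<lambda>i. p - i" "\<lambda>i. p - i"]) auto
  also have "2 * wt p * ((\<Sum>i\<le>p. wt i) + (\<Sum>i\<le>p. wt i)) \<le> 2 * wt p * (2 + 2)"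
    using sum_wt_le[of p] wt_pos[of p] by (intro mult_left_mono add_mono) (auto intro: order.trans)
  finally show ?thesis by simp
qed

text \<open>The factor \<open>1 / 256\<close> makes six times the threefold convolution at most the majorant itself.\<close>

definition majorant :: "real \<Rightarrow> nat \<Rightarrow> nat \<Rightarrow> real" where
  "majorant M p q = M ^ (p + q) * wt p * wt q / 256"

lemma majorant_nonneg: "M > 0 \<Longrightarrow> majorant M p q \<ge> 0"
  using wt_pos[of p] wt_pos[of q] by (simp add: majorant_def)

lemma majorant_le: "M > 0 \<Longrightarrow> majorant M p q \<le> M ^ (p + q)"
proof -
  assume "M > 0"
  then have "M ^ (p + q) * (wt p * wt q) \<le> M ^ (p + q) * (1 * 1)"
    using wt_pos[of p] wt_pos[of q] by (intro mult_left_mono mult_mono wt_le_1) auto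
  moreover have "M ^ (p + q) > 0" using \<open>M > 0\<close> by simp
  ultimately show ?thesis
    unfolding majorant_def by (simp add: mult.assoc)
qed

text \<open>Each variable contributes a factor \<open>8\<close>, and one of the two normalising
  factors \<open>1 / 256\<close> remains to absorb them: \<open>64 / 256 = 1 / 4\<close>.\<close>

lemma conv_majorant:
  assumes "M > 0"
  shows "conv (majorant M) (majorant M) p q \<le> majorant M p q / 4"
proof -
  have "conv (majorant M) (majorant M) p q =
      (\<Sum>i\<le>p. \<Sum>j\<le>q. M ^ (p + q) / 65536 * ((wt i * wt (p - i)) * (wt j * wt (q - j))))"
    unfolding conv_def by (intro sum.cong) (auto simp: majorant_def le_iff_add power_add)
  also have "\<dots> = M ^ (p + q) / 65536 * ((\<Sum>i\<le>p. wt i * wt (p - i)) * (\<Sum>j\<le>q. wt j * wt (q - j)))"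
    by (subst sum_product) (simp add: sum_distrib_left)
  also have "\<dots> \<le> M ^ (p + q) / 65536 * ((8 * wt p) * (8 * wt q))"
    using assms wt_pos[THEN less_imp_le]
    by (intro mult_left_mono mult_mono sum_wt_mult_le sum_nonneg mult_nonneg_nonneg) auto
  also have "\<dots> = majorant M p q / 4"
    by (simp add: majorant_def)
  finally show ?thesis .
qed

lemma conv_conv_majorant:
  assumes "M > 0"
  shows "conv (majorant M) (conv (majorant M) (majorant M)) p q \<le> majorant M p q / 16"
proof -
  have "conv (majorant M) (conv (majorant M) (majorant M)) p q \<le> conv (majorant M) (\<lambda>p q. majorant M p q / 4) p q"
    unfolding conv_def[of _ "conv _ _"] conv_def[of _ "\<lambda>p q. _ p q / 4"]
    using assms by (intro sum_mono mult_left_mono conv_majorant majorant_nonneg)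
  also have "\<dots> = conv (majorant M) (majorant M) p q / 4"
    by (simp add: conv_def sum_divide_distrib)
  also have "\<dots> \<le> majorant M p q / 4 / 4"
    using conv_majorant[OF assms, of p q] by simp
  finally show ?thesis by simp
qed

lemma abs_trilinear_le:
  fixes c :: real
  assumes "\<bar>c\<bar> \<le> C" "\<bar>x\<bar> \<le> X" "\<bar>y\<bar> \<le> Y" "\<bar>z\<bar> \<le> Z"
  shows "\<bar>c * x * y * z\<bar> \<le> C * (X * Y * Z)"
  unfolding abs_mult mult.assoc using assms
  by (intro mult_mono mult_nonneg_nonneg) (auto intro: order.trans[OF abs_ge_zero])

text \<open>The induction lets \<open>a\<close> and \<open>b\<close> vary because the coefficients
  of \<open>u\<close> recur to those of \<open>v\<close>, where their roles are exchanged. Off the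
  axes the bound closes since \<open>6 / 16 \<le> 1\<close>.\<close>

lemma forced_coef_le_majorant:
  assumes "M > 0"
    and "\<And>l. l \<ge> 1 \<Longrightarrow> \<bar>a l 0\<bar> \<le> majorant M l 0" "\<And>l. l \<ge> 1 \<Longrightarrow> \<bar>a l l\<bar> \<le> majorant M 0 l"
    and "\<And>l. l \<ge> 1 \<Longrightarrow> \<bar>b l 0\<bar> \<le> majorant M l 0" "\<And>l. l \<ge> 1 \<Longrightarrow> \<bar>b l l\<bar> \<le> majorant M 0 l"
  shows "\<bar>forced_coef a b p q\<bar> \<le> majorant M p q"
  using assms(2-)
proof (induction "p + q" arbitrary: a b p q rule: less_induct)
  case less
  define B where "B = majorant M"
  define u v where "u = forced_coef a b" and "v = forced_coef b a"
  consider "p = 0" "q = 0" | "p \<noteq> 0" "q = 0" | "p = 0" "q \<noteq> 0" | "p \<noteq> 0" "q \<noteq> 0"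
    by blast
  then show ?case
  proof cases
    case 4
    let ?F = "\<lambda>(i1, j1, i2, j2, i3, j3).
        2 * real i2 * real j3 * u i1 j1 * u i2 j2 * u i3 j3
      + real i2 * real j3 * v i1 j1 * u i2 j2 * v i3 j3
      + real j2 * real i3 * v i1 j1 * u i2 j2 * v i3 j3
      - real i3 * real j3 * (u i1 j1 * u i2 j2 + v i1 j1 * v i2 j2) * u i3 j3"
    let ?G = "\<lambda>(i1, j1, i2, j2, i3, j3). B i1 j1 * B i2 j2 * B i3 j3"
    have B_nonneg: "B i j \<ge> 0" for i j
      using majorant_nonneg[OF \<open>M > 0\<close>] by (simp add: B_def)
    have term_le: "\<bar>?F t\<bar> \<le> 6 * (real p * real q) * ?G t" if "t \<in> splittings p q" for t
    proof -
      obtain i1 j1 i2 j2 i3 j3 where t: "t = (i1, j1, i2, j2, i3, j3)"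
        by (metis prod.exhaust)
      note D = splittingsD[OF that[unfolded t]]
      have IH: "\<bar>u i j\<bar> \<le> B i j" "\<bar>v i j\<bar> \<le> B i j" if "i + j + 2 \<le> p + q" for i j
        using that unfolding u_def v_def B_def by (intro less.hyps less.prems; simp)+
      have le: "\<bar>real i * real j\<bar> \<le> real p * real q" if "i \<le> p" "j \<le> q" for i j
        using that by (simp add: mult_mono)
      note tri = abs_trilinear_le[OF le]
      \<comment> \<open>Counted with multiplicities \<open>2 + 1 + 1 + 1 + 1\<close>, these bounds
        give the factor \<open>6\<close>. In the third, \<open>i3\<close> is put before
        \<open>j2\<close> so that the exponents are compared with \<open>p\<close> and
        \<open>q\<close> in this order.\<close>
      have "\<bar>real i2 * real j3 * u i1 j1 * u i2 j2 * u i3 j3\<bar> \<le> real p * real q * ?G t"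
        "\<bar>real i2 * real j3 * v i1 j1 * u i2 j2 * v i3 j3\<bar> \<le> real p * real q * ?G t"
        "\<bar>real i3 * real j2 * v i1 j1 * u i2 j2 * v i3 j3\<bar> \<le> real p * real q * ?G t"
        "\<bar>real i3 * real j3 * u i1 j1 * u i2 j2 * u i3 j3\<bar> \<le> real p * real q * ?G t"
        "\<bar>real i3 * real j3 * v i1 j1 * v i2 j2 * u i3 j3\<bar> \<le> real p * real q * ?G t"
        unfolding t prod.case by (intro tri D IH)+
      moreover have "?F t = 2 * (real i2 * real j3 * u i1 j1 * u i2 j2 * u i3 j3)
          + real i2 * real j3 * v i1 j1 * u i2 j2 * v i3 j3
          + real i3 * real j2 * v i1 j1 * u i2 j2 * v i3 j3
          - real i3 * real j3 * u i1 j1 * u i2 j2 * u i3 j3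
          - real i3 * real j3 * v i1 j1 * v i2 j2 * u i3 j3"
        by (simp add: t algebra_simps)
      ultimately show ?thesis
        by (simp only: mult.assoc[of 6])
    qed
    have pq: "real p * real q > 0" using 4 by simp
    have "\<bar>sum ?F (splittings p q)\<bar> \<le> (\<Sum>t\<in>splittings p q. 6 * (real p * real q) * ?G t)"
      by (rule order.trans[OF sum_abs sum_mono[OF term_le]])
    \<comment> \<open>The enlargement adds only nonnegative terms and makes the sum a
      convolution.\<close>
    also have "\<dots> \<le> (\<Sum>t\<in>triples p q. 6 * (real p * real q) * ?G t)"
      using B_nonneg pq by (intro sum_mono2 finite_triples splittings_subset_triples) auto
    also have "\<dots> = 6 * (real p * real q) * conv B (conv B B) p q"
      by (simp add: sum_triples flip: sum_distrib_left)
    also have "\<dots> \<le> 6 * (real p * real q) * (B p q / 16)"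
      unfolding B_def using pq by (intro mult_left_mono conv_conv_majorant \<open>M > 0\<close>) auto
    also have "\<dots> \<le> real p * real q * B p q"
      using pq B_nonneg[of p q] by simp
    finally have "\<bar>sum ?F (splittings p q)\<bar> / (real p * real q) \<le> B p q"
      using pq by (simp add: divide_le_eq mult.commute)
    moreover have "u p q = sum ?F (splittings p q) / (real p * real q)"
      unfolding u_def v_def using 4 by (subst forced_coef.simps) simp
    ultimately show ?thesis
      using pq unfolding u_def B_def by (simp add: abs_divide)
  qed (use less.prems majorant_nonneg[OF \<open>M > 0\<close>] in \<open>simp_all add: forced_coef_axes\<close>)
qed

text \<open>For \<open>l \<ge> 1\<close> the first power of \<open>M \<ge> 1\<close> already
  suffices, so \<open>M\<close> need only exceed finitely many numbers. All larger \<open>M'\<close>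
  are included so that several sequences can share one constant.\<close>

lemma exists_majorant_bound:
  fixes c :: "nat \<Rightarrow> real"
  assumes "\<And>l. l > n \<Longrightarrow> c l = 0"
  obtains M where "M \<ge> 1" "\<And>M' l. M' \<ge> M \<Longrightarrow> l \<ge> 1 \<Longrightarrow> \<bar>c l\<bar> \<le> majorant M' l 0 \<and> \<bar>c l\<bar> \<le> majorant M' 0 l"
proof
  \<comment> \<open>The factor \<open>256 / wt l\<close> undoes the normalisation of
    \<open>majorant\<close>, where \<open>wt 0 = 1\<close>.\<close>
  define M where "M = 1 + (\<Sum>l\<le>n. 256 * \<bar>c l\<bar> / wt l)"
  show "M \<ge> 1"
    unfolding M_def using wt_pos[THEN less_imp_le] by (simp add: sum_nonneg)
  fix M' l assume M': "M' \<ge> M" and l: "l \<ge> (1 :: nat)"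
  have "\<bar>c l\<bar> \<le> majorant M' l 0"
  proof (cases "l \<le> n")
    case True
    have "256 * \<bar>c l\<bar> / wt l \<le> (\<Sum>l\<le>n. 256 * \<bar>c l\<bar> / wt l)"
      using True wt_pos[THEN less_imp_le] by (intro member_le_sum) auto
    also have "\<dots> \<le> M' ^ 1"
      using M' by (simp add: M_def)
    also have "\<dots> \<le> M' ^ l"
      using l M' \<open>M \<ge> 1\<close> by (intro power_increasing) auto
    finally show ?thesis
      using wt_pos[of l] by (simp add: majorant_def divide_le_eq wt_def[of 0])
  next
    case False
    then show ?thesis
      using assms[of l] M' \<open>M \<ge> 1\<close> majorant_nonneg[of M' l 0] by simp
  qed
  moreover have "majorant M' l 0 = majorant M' 0 l"
    by (simp add: majorant_def)
  ultimately show "\<bar>c l\<bar> \<le> majorant M' l 0 \<and> \<bar>c l\<bar> \<le> majorant M' 0 l"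
    by simp
qed

lemma forced_coef_pser:
  assumes "\<And>l. l > n \<Longrightarrow> a l 0 = 0 \<and> a l l = 0 \<and> b l 0 = 0 \<and> b l l = 0"
  obtains r u v where "pser (forced_coef a b) r u" "pser (forced_coef b a) r v"
proof -
  obtain M1 where M1: "M1 \<ge> 1"
      "\<And>M' l. M' \<ge> M1 \<Longrightarrow> l \<ge> 1 \<Longrightarrow> \<bar>a l 0\<bar> \<le> majorant M' l 0 \<and> \<bar>a l 0\<bar> \<le> majorant M' 0 l"
    by (rule exists_majorant_bound[of n "\<lambda>l. a l 0"]) (use assms in simp, blast)
  obtain M2 where M2: "M2 \<ge> 1"
      "\<And>M' l. M' \<ge> M2 \<Longrightarrow> l \<ge> 1 \<Longrightarrow> \<bar>a l l\<bar> \<le> majorant M' l 0 \<and> \<bar>a l l\<bar> \<le> majorant M' 0 l"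
    by (rule exists_majorant_bound[of n "\<lambda>l. a l l"]) (use assms in simp, blast)
  obtain M3 where M3: "M3 \<ge> 1"
      "\<And>M' l. M' \<ge> M3 \<Longrightarrow> l \<ge> 1 \<Longrightarrow> \<bar>b l 0\<bar> \<le> majorant M' l 0 \<and> \<bar>b l 0\<bar> \<le> majorant M' 0 l"
    by (rule exists_majorant_bound[of n "\<lambda>l. b l 0"]) (use assms in simp, blast)
  obtain M4 where M4: "M4 \<ge> 1"
      "\<And>M' l. M' \<ge> M4 \<Longrightarrow> l \<ge> 1 \<Longrightarrow> \<bar>b l l\<bar> \<le> majorant M' l 0 \<and> \<bar>b l l\<bar> \<le> majorant M' 0 l"
    by (rule exists_majorant_bound[of n "\<lambda>l. b l l"]) (use assms in simp, blast)
  define M' where "M' = M1 + M2 + M3 + M4"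
  have M': "M' > 0" "M' \<ge> M1" "M' \<ge> M2" "M' \<ge> M3" "M' \<ge> M4"
    using M1(1) M2(1) M3(1) M4(1) by (auto simp: M'_def)
  note M = M1(2)[OF M'(2)] M2(2)[OF M'(3)] M3(2)[OF M'(4)] M4(2)[OF M'(5)]
  have "norm (forced_coef a b i j) \<le> M' ^ (i + j)" "norm (forced_coef b a i j) \<le> M' ^ (i + j)" for i j
    using forced_coef_le_majorant[OF M'(1), of a b i j] forced_coef_le_majorant[OF M'(1), of b a i j]
      M majorant_le[OF M'(1), of i j] by auto
  from pser_of_bound[OF M'(1) this(1)] pser_of_bound[OF M'(1) this(2)] show thesis
    by (rule that)
qed

subsection \<open>Null coordinates\<close>

lemma pdx_cong:
  assumes "open U" "p \<in> U" "\<And>q. q \<in> U \<Longrightarrow> f q = g q"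
  shows "pdx f p = pdx g p" "pdy f p = pdy g p"
proof -
  obtain A B where AB: "open A" "open B" "p \<in> A \<times> B" "A \<times> B \<subseteq> U"
    using open_prod_elim[OF assms(1,2)] by metis
  have ev: "\<forall>\<^sub>F t in nhds (fst p). t \<in> A" "\<forall>\<^sub>F t in nhds (snd p). t \<in> B"
    using AB by (auto intro!: eventually_nhds_in_open)
  from ev(1) have "\<forall>\<^sub>F t in nhds (fst p). f (t, snd p) = g (t, snd p)"
    by eventually_elim (use AB assms(3) in auto)
  moreover from ev(2) have "\<forall>\<^sub>F t in nhds (snd p). f (fst p, t) = g (fst p, t)"
    by eventually_elim (use AB assms(3) in auto)
  ultimately show "pdx f p = pdx g p" "pdy f p = pdy g p"
    unfolding pdx_def pdy_def by (auto intro!: vector_derivative_cong_eq)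
qed

lemma
  assumes "f differentiable (at (\<psi> q))" "\<psi> differentiable (at q)"
  shows pdx_compose: "pdx (\<lambda>p. f (\<psi> p)) q = fst (pdx \<psi> q) *\<^sub>R pdx f (\<psi> q) + snd (pdx \<psi> q) *\<^sub>R pdy f (\<psi> q)"
    and pdy_compose: "pdy (\<lambda>p. f (\<psi> p)) q = fst (pdy \<psi> q) *\<^sub>R pdx f (\<psi> q) + snd (pdy \<psi> q) *\<^sub>R pdy f (\<psi> q)"
proof -
  note D = has_derivative_compose[OF has_derivative_pd[OF assms(2)] has_derivative_pd[OF assms(1)]]
  show "pdx (\<lambda>p. f (\<psi> p)) q = fst (pdx \<psi> q) *\<^sub>R pdx f (\<psi> q) + snd (pdx \<psi> q) *\<^sub>R pdy f (\<psi> q)"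
    using pdx_eq[OF D] by simp
  show "pdy (\<lambda>p. f (\<psi> p)) q = fst (pdy \<psi> q) *\<^sub>R pdx f (\<psi> q) + snd (pdy \<psi> q) *\<^sub>R pdy f (\<psi> q)"
    using pdy_eq[OF D] by simp
qed

lemma
  assumes "f differentiable (at q)" "bounded_linear k"
  shows pdx_bounded_linear: "pdx (\<lambda>p. k (f p)) q = k (pdx f q)"
    and pdy_bounded_linear: "pdy (\<lambda>p. k (f p)) q = k (pdy f q)"
proof -
  note D = bounded_linear.has_derivative[OF assms(2) has_derivative_pd[OF assms(1)]]
  show "pdx (\<lambda>p. k (f p)) q = k (pdx f q)" using pdx_eq[OF D] by simp
  show "pdy (\<lambda>p. k (f p)) q = k (pdy f q)" using pdy_eq[OF D] by simp
qed

lemma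
  fixes f g :: "real \<times> real \<Rightarrow> real"
  assumes "f differentiable (at q)" "g differentiable (at q)"
  shows pdx_mult: "pdx (\<lambda>p. f p * g p) q = f q * pdx g q + pdx f q * g q"
    and pdy_mult: "pdy (\<lambda>p. f p * g p) q = f q * pdy g q + pdy f q * g q"
    and pdx_add: "pdx (\<lambda>p. f p + g p) q = pdx f q + pdx g q"
    and pdy_add: "pdy (\<lambda>p. f p + g p) q = pdy f q + pdy g q"
proof -
  note D = has_derivative_mult[OF has_derivative_pd[OF assms(1)] has_derivative_pd[OF assms(2)]]
  note D' = has_derivative_add[OF has_derivative_pd[OF assms(1)] has_derivative_pd[OF assms(2)]]
  show "pdx (\<lambda>p. f p * g p) q = f q * pdx g q + pdx f q * g q" using pdx_eq[OF D] by simp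
  show "pdy (\<lambda>p. f p * g p) q = f q * pdy g q + pdy f q * g q" using pdy_eq[OF D] by simp
  show "pdx (\<lambda>p. f p + g p) q = pdx f q + pdx g q" using pdx_eq[OF D'] by simp
  show "pdy (\<lambda>p. f p + g p) q = pdy f q + pdy g q" using pdy_eq[OF D'] by simp
qed

lemma null_coordinates_differentiable:
  assumes "null_coordinates V W \<psi> \<phi>"
  shows "q \<in> V \<Longrightarrow> \<psi> differentiable (at q)" "p \<in> W \<Longrightarrow> \<phi> differentiable (at p)"
    and "continuous_on V (pdx \<psi>)"
proof -
  have "Ck_on 1 V \<psi>" "Ck_on 1 W \<phi>" "open V" "open W"
    using assms unfolding null_coordinates_def smooth_on_def by auto
  then show "q \<in> V \<Longrightarrow> \<psi> differentiable (at q)" "p \<in> W \<Longrightarrow> \<phi> differentiable (at p)"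
      "continuous_on V (pdx \<psi>)"
    by (auto simp: differentiable_on_eq_differentiable_at)
qed

text \<open>A null vector has a vanishing component. The chain rule for the chart and its inverse
  makes the Jacobian invertible, so the two coordinate fields lie on different axes.\<close>

lemma null_coordinates_cases:
  assumes null: "null_coordinates V W \<psi> \<phi>" and "q \<in> V"
  shows "fst (pdx \<psi> q) \<noteq> 0 \<and> snd (pdx \<psi> q) = 0 \<and> fst (pdy \<psi> q) = 0 \<and> snd (pdy \<psi> q) \<noteq> 0 \<or>
    fst (pdx \<psi> q) = 0 \<and> snd (pdx \<psi> q) \<noteq> 0 \<and> fst (pdy \<psi> q) \<noteq> 0 \<and> snd (pdy \<psi> q) = 0"
proof -
  have V: "open V" and inv: "\<And>p. p \<in> V \<Longrightarrow> \<phi> (\<psi> p) = p" and "\<psi> q \<in> W"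
    and lor: "lorentz (pdx \<psi> q) (pdx \<psi> q) = 0" "lorentz (pdy \<psi> q) (pdy \<psi> q) = 0"
    using assms unfolding null_coordinates_def homeomorphism_def by auto
  define A B where "A = pdx \<phi> (\<psi> q)" and "B = pdy \<phi> (\<psi> q)"
  have diff: "\<phi> differentiable (at (\<psi> q))" "\<psi> differentiable (at q)"
    using null_coordinates_differentiable[OF null] \<open>\<psi> q \<in> W\<close> \<open>q \<in> V\<close> by auto
  have id: "pdx (\<lambda>p. p) q = (1, 0)" "pdy (\<lambda>p. p) q = (0, 1)"
    using pdx_eq[OF has_derivative_ident] pdy_eq[OF has_derivative_ident] by auto
  have x: "fst (pdx \<psi> q) *\<^sub>R A + snd (pdx \<psi> q) *\<^sub>R B = (1, 0)"
    unfolding A_def B_def pdx_compose[OF diff, symmetric] id[symmetric]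
    by (rule pdx_cong[OF V \<open>q \<in> V\<close> inv])
  have y: "fst (pdy \<psi> q) *\<^sub>R A + snd (pdy \<psi> q) *\<^sub>R B = (0, 1)"
    unfolding A_def B_def pdy_compose[OF diff, symmetric] id[symmetric]
    by (rule pdx_cong[OF V \<open>q \<in> V\<close> inv])
  have "fst (pdx \<psi> q) = 0 \<or> snd (pdx \<psi> q) = 0" "fst (pdy \<psi> q) = 0 \<or> snd (pdy \<psi> q) = 0"
    using lor by (auto simp: lorentz_def)
  then show ?thesis
    using x y by (auto simp: prod_eq_iff)
qed

text \<open>Vertical sections of a box are intervals, so \<open>g\<close> depends there on the first
  coordinate alone, and so does its derivative.\<close>

lemma pdx_independent_of_y:
  fixes g :: "real \<times> real \<Rightarrow> real"
  assumes diff: "\<And>p. p \<in> ball a e \<times> ball b e \<Longrightarrow> g differentiable (at p)"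
    and 0: "\<And>p. p \<in> ball a e \<times> ball b e \<Longrightarrow> pdy g p = 0"
    and xy: "x \<in> ball a e" "y \<in> ball b e"
  shows "pdx g (x, y) = pdx g (x, b)"
proof -
  have "e > 0" using xy(1) by (auto simp: ball_def intro: le_less_trans[OF zero_le_dist])
  have const: "g (x, t) = g (x, b)" if "x \<in> ball a e" "t \<in> ball b e" for x t
  proof -
    have "((\<lambda>t. g (x, t)) has_field_derivative 0) (at t within ball b e)" if t: "t \<in> ball b e" for t
    proof -
      have p: "(x, t) \<in> ball a e \<times> ball b e" using \<open>x \<in> ball a e\<close> t by simp
      have "((\<lambda>t. (x, t)) has_derivative (\<lambda>h. (0, h))) (at t)"
        by (auto intro!: derivative_eq_intros)
      from has_derivative_compose[OF this has_derivative_pd[OF diff[OF p]]]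
      have "((\<lambda>t. g (x, t)) has_field_derivative 0) (at t)"
        by (simp add: 0[OF p] has_field_derivative_def lambda_zero)
      then show ?thesis
        by (rule has_field_derivative_at_within)
    qed
    then obtain c where "\<forall>t\<in>ball b e. g (x, t) = c"
      using has_field_derivative_zero_constant[OF convex_ball] by blast
    then show ?thesis
      using that \<open>e > 0\<close> by simp
  qed
  have "\<forall>\<^sub>F t in nhds x. t \<in> ball a e"
    using xy by (intro eventually_nhds_in_open) auto
  then have "\<forall>\<^sub>F t in nhds x. g (t, y) = g (t, b)"
    by eventually_elim (use const xy in auto)
  then show ?thesis
    unfolding pdx_def by (auto intro!: vector_derivative_cong_eq)
qed

text \<open>Intended for \<open>G = N \<circ> \<psi>\<close>, with \<open>k\<close> the component of
  the chart that depends on the first variable only and \<open>M\<close> the matching partial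
  derivative of \<open>N\<close>. The scalar \<open>k (pdx \<psi> p)\<close> is constant in the
  second variable, so the second differentiation falls on \<open>M\<close> alone.\<close>

lemma pdy_pdx_null_coordinates:
  fixes M G :: "real \<times> real \<Rightarrow> 'b::banach" and k :: "real \<times> real \<Rightarrow> real"
  assumes "e > 0"
    and diff: "\<And>p. p \<in> ball a e \<times> ball b e \<Longrightarrow> \<psi> differentiable (at p)"
    and k: "bounded_linear k" and 0: "\<And>p. p \<in> ball a e \<times> ball b e \<Longrightarrow> k (pdy \<psi> p) = 0"
    and G: "\<And>p. p \<in> ball a e \<times> ball b e \<Longrightarrow> pdx G p = k (pdx \<psi> p) *\<^sub>R M (\<psi> p)"
    and M: "M differentiable (at (\<psi> (a, b)))"
  shows "pdy (pdx G) (a, b) = k (pdx \<psi> (a, b)) *\<^sub>R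
    (fst (pdy \<psi> (a, b)) *\<^sub>R pdx M (\<psi> (a, b)) + snd (pdy \<psi> (a, b)) *\<^sub>R pdy M (\<psi> (a, b)))"
proof -
  have ab: "(a, b) \<in> ball a e \<times> ball b e"
    using \<open>e > 0\<close> by simp
  have diff_k: "(\<lambda>p. k (\<psi> p)) differentiable (at p)" if "p \<in> ball a e \<times> ball b e" for p
    using bounded_linear.has_derivative[OF k has_derivative_pd[OF diff[OF that]]]
    unfolding differentiable_def by blast
  have k_pd: "pdx (\<lambda>p. k (\<psi> p)) p = k (pdx \<psi> p)" "pdy (\<lambda>p. k (\<psi> p)) p = k (pdy \<psi> p)"
    if "p \<in> ball a e \<times> ball b e" for p
    using pdx_bounded_linear[OF diff k] pdy_bounded_linear[OF diff k] that by auto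
  have const: "k (pdx \<psi> (a, t)) = k (pdx \<psi> (a, b))" if "t \<in> ball b e" for t
    using pdx_independent_of_y[OF diff_k, of a e b a t] that ab by (simp add: k_pd 0)
  have G': "pdx G (a, t) = k (pdx \<psi> (a, b)) *\<^sub>R M (\<psi> (a, t))" if "t \<in> ball b e" for t
    using G[of "(a, t)"] const[OF that] that ab by simp
  have "\<forall>\<^sub>F t in nhds b. t \<in> ball b e"
    using \<open>e > 0\<close> by (intro eventually_nhds_in_open) auto
  then have "\<forall>\<^sub>F t in nhds b. pdx G (a, t) = k (pdx \<psi> (a, b)) *\<^sub>R M (\<psi> (a, t))"
    by eventually_elim (rule G')
  then have "pdy (pdx G) (a, b) = pdy (\<lambda>p. k (pdx \<psi> (a, b)) *\<^sub>R M (\<psi> p)) (a, b)"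
    unfolding pdy_def by (auto intro!: vector_derivative_cong_eq)
  also have "\<dots> = k (pdx \<psi> (a, b)) *\<^sub>R pdy (\<lambda>p. M (\<psi> p)) (a, b)"
    using differentiable_chain_at[OF diff[OF ab] M]
    by (intro pdy_bounded_linear bounded_linear_scaleR_right) (simp add: o_def)
  finally show ?thesis
    by (simp add: pdy_compose[OF M diff[OF ab]])
qed

lemma cross3_harmonic_null_coordinates:
  fixes N :: "real \<times> real \<Rightarrow> real ^ 3"
  assumes N: "pser c r N"
    and H: "\<And>p. p \<in> {-r<..<r} \<times> {-r<..<r} \<Longrightarrow> cross3 (N p) (pdy (pdx N) p) = 0"
    and null: "null_coordinates V W \<psi> \<phi>" and W: "W \<subseteq> {-r<..<r} \<times> {-r<..<r}" and "q \<in> V"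
  shows "cross3 (N (\<psi> q)) (pdy (pdx (N \<circ> \<psi>)) q) = 0"
proof -
  obtain a b where q: "q = (a, b)" by fastforce
  have V: "open V" and \<psi>W: "\<And>p. p \<in> V \<Longrightarrow> \<psi> p \<in> W"
    using null unfolding null_coordinates_def homeomorphism_def by auto
  note diff = null_coordinates_differentiable(1)[OF null]
  have box: "\<bar>fst (\<psi> p)\<bar> < r" "\<bar>snd (\<psi> p)\<bar> < r" if "p \<in> V" for p
    using subsetD[OF W \<psi>W[OF that]] by (cases "\<psi> p"; auto)+
  have diff_box: "f differentiable (at (\<psi> p))" if "pser d r f" "p \<in> V" for d p and f :: "real \<times> real \<Rightarrow> real ^ 3"
    using pser_differentiable[OF that(1), of "fst (\<psi> p)" "snd (\<psi> p)"] box[OF that(2)] by simp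
  \<comment> \<open>A chart that exchanges the coordinates produces the mixed derivative in the
    other order; both orders have the same coefficients.\<close>
  have swap: "pdx (pdy N) (\<psi> q) = pdy (pdx N) (\<psi> q)"
  proof -
    have "pser (\<lambda>i j. real (Suc j) *\<^sub>R real (Suc i) *\<^sub>R c (Suc i) (Suc j)) r (pdx (pdy N))"
      using pser_pdx[OF pser_pdy[OF N]] by (simp add: mult.commute)
    from pser_unique[OF this pser_pdy[OF pser_pdx[OF N]], of "fst (\<psi> q)" "snd (\<psi> q)"]
    show ?thesis using box[OF \<open>q \<in> V\<close>] by simp
  qed
  have chain: "pdx (N \<circ> \<psi>) p = fst (pdx \<psi> p) *\<^sub>R pdx N (\<psi> p) + snd (pdx \<psi> p) *\<^sub>R pdy N (\<psi> p)"
    if "p \<in> V" for p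
    using pdx_compose[OF diff_box[OF N that] diff[OF that]] by (simp add: o_def)
  note cases = null_coordinates_cases[OF null]
  \<comment> \<open>By continuity of \<open>pdx \<psi>\<close>, the alternative of
    \<open>null_coordinates_cases\<close> valid at \<open>q\<close> persists on a whole box, as
    \<open>pdy_pdx_null_coordinates\<close> requires.\<close>
  have rect: "\<exists>e>0. \<forall>p\<in>ball a e \<times> ball b e. p \<in> V \<and> k (pdx \<psi> p) \<noteq> 0"
    if "bounded_linear k" "k (pdx \<psi> q) \<noteq> 0" for k :: "real \<times> real \<Rightarrow> real"
  proof -
    have "continuous_on V (\<lambda>p. k (pdx \<psi> p))"
      by (rule bounded_linear.continuous_on[OF that(1) null_coordinates_differentiable(3)[OF null]])
    then have "open (V \<inter> (\<lambda>p. k (pdx \<psi> p)) -` (- {0}))"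
      by (intro continuous_open_preimage V) auto
    moreover have "q \<in> V \<inter> (\<lambda>p. k (pdx \<psi> p)) -` (- {0})"
      using that \<open>q \<in> V\<close> by simp
    ultimately obtain A B where AB: "open A" "open B" "(a, b) \<in> A \<times> B"
        "A \<times> B \<subseteq> V \<inter> (\<lambda>p. k (pdx \<psi> p)) -` (- {0})"
      unfolding q using open_prod_elim by metis
    then obtain e1 e2 where "e1 > 0" "e2 > 0" "ball a e1 \<subseteq> A" "ball b e2 \<subseteq> B"
      by (metis open_contains_ball mem_Sigma_iff)
    with AB show ?thesis
      by (intro exI[of _ "min e1 e2"]) (auto simp: subset_iff)
  qed
  have "\<exists>s. pdy (pdx (N \<circ> \<psi>)) q = s *\<^sub>R pdy (pdx N) (\<psi> q)"
  proof (cases "fst (pdx \<psi> q) = 0")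
    case False
    with rect[OF bounded_linear_fst] obtain e where e: "e > 0"
      "\<And>p. p \<in> ball a e \<times> ball b e \<Longrightarrow> p \<in> V \<and> fst (pdx \<psi> p) \<noteq> 0" by blast
    have "pdy (pdx (N \<circ> \<psi>)) (a, b) = fst (pdx \<psi> (a, b)) *\<^sub>R
      (fst (pdy \<psi> (a, b)) *\<^sub>R pdx (pdx N) (\<psi> (a, b)) + snd (pdy \<psi> (a, b)) *\<^sub>R pdy (pdx N) (\<psi> (a, b)))"
    proof (rule pdy_pdx_null_coordinates[OF e(1) _ bounded_linear_fst])
      show "pdx N differentiable (at (\<psi> (a, b)))"
        using diff_box[OF pser_pdx[OF N] \<open>q \<in> V\<close>] by (simp add: q)
      fix p assume "p \<in> ball a e \<times> ball b e"
      from e(2)[OF this] have p: "p \<in> V" "fst (pdx \<psi> p) \<noteq> 0" by auto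
      then have "snd (pdx \<psi> p) = 0" "fst (pdy \<psi> p) = 0"
        using cases[OF p(1)] by auto
      then show "\<psi> differentiable (at p)" "fst (pdy \<psi> p) = 0"
          "pdx (N \<circ> \<psi>) p = fst (pdx \<psi> p) *\<^sub>R pdx N (\<psi> p)"
        using chain[OF p(1)] diff[OF p(1)] by simp_all
    qed
    with cases[OF \<open>q \<in> V\<close>] False q show ?thesis by auto
  next
    case True
    with cases[OF \<open>q \<in> V\<close>] have "snd (pdx \<psi> q) \<noteq> 0" by auto
    with rect[OF bounded_linear_snd] obtain e where e: "e > 0"
      "\<And>p. p \<in> ball a e \<times> ball b e \<Longrightarrow> p \<in> V \<and> snd (pdx \<psi> p) \<noteq> 0" by blast
    have "pdy (pdx (N \<circ> \<psi>)) (a, b) = snd (pdx \<psi> (a, b)) *\<^sub>R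
      (fst (pdy \<psi> (a, b)) *\<^sub>R pdx (pdy N) (\<psi> (a, b)) + snd (pdy \<psi> (a, b)) *\<^sub>R pdy (pdy N) (\<psi> (a, b)))"
    proof (rule pdy_pdx_null_coordinates[OF e(1) _ bounded_linear_snd])
      show "pdy N differentiable (at (\<psi> (a, b)))"
        using diff_box[OF pser_pdy[OF N] \<open>q \<in> V\<close>] by (simp add: q)
      fix p assume "p \<in> ball a e \<times> ball b e"
      from e(2)[OF this] have p: "p \<in> V" "snd (pdx \<psi> p) \<noteq> 0" by auto
      then have "fst (pdx \<psi> p) = 0" "snd (pdy \<psi> p) = 0"
        using cases[OF p(1)] by auto
      then show "\<psi> differentiable (at p)" "snd (pdy \<psi> p) = 0"
          "pdx (N \<circ> \<psi>) p = snd (pdx \<psi> p) *\<^sub>R pdy N (\<psi> p)"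
        using chain[OF p(1)] diff[OF p(1)] by simp_all
    qed
    with cases[OF \<open>q \<in> V\<close>] True q swap show ?thesis by auto
  qed
  then obtain s where "pdy (pdx (N \<circ> \<psi>)) q = s *\<^sub>R pdy (pdx N) (\<psi> q)" ..
  moreover have "cross3 (N (\<psi> q)) (pdy (pdx N) (\<psi> q)) = 0"
    using H \<psi>W[OF \<open>q \<in> V\<close>] W by auto
  ultimately show ?thesis
    by (simp add: cross_mult_right)
qed

subsection \<open>The normalised map and its jets\<close>

lemma pdy_pdx_mult:
  fixes f g :: "real \<times> real \<Rightarrow> real"
  assumes f: "pser c r f" and g: "pser d r g" and p: "p \<in> {-r<..<r} \<times> {-r<..<r}"
  shows "pdy (pdx (\<lambda>p. f p * g p)) p =
    pdy (pdx f) p * g p + pdx f p * pdy g p + pdy f p * pdx g p + f p * pdy (pdx g) p"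
proof -
  have diff: "h differentiable (at q)" if "pser e r h" "q \<in> {-r<..<r} \<times> {-r<..<r}" for e q and h :: "real \<times> real \<Rightarrow> real"
    using pser_differentiable[OF that(1), of "fst q" "snd q"] that(2) by (cases q) auto
  have "pdy (pdx (\<lambda>p. f p * g p)) p = pdy (\<lambda>p. f p * pdx g p + pdx f p * g p) p"
    by (rule pdx_cong[OF _ p]) (auto intro!: open_Times pdx_mult diff[OF f] diff[OF g])
  also have "\<dots> = pdy (\<lambda>p. f p * pdx g p) p + pdy (\<lambda>p. pdx f p * g p) p"
    by (rule pdy_add[OF diff[OF pser_mult[OF f pser_pdx[OF g]] p] diff[OF pser_mult[OF pser_pdx[OF f] g] p]])
  also have "\<dots> = f p * pdy (pdx g) p + pdy f p * pdx g p + (pdx f p * pdy g p + pdy (pdx f) p * g p)"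
    by (simp add: pdy_mult[OF diff[OF f p] diff[OF pser_pdx[OF g] p]]
        pdy_mult[OF diff[OF pser_pdx[OF f] p] diff[OF g p]])
  finally show ?thesis by simp
qed

text \<open>The mixed derivative of \<open>N\<close> is that of \<open>w\<close> times the vector
  \<open>[u p, v p, 1]\<close>, which is parallel to \<open>N p\<close>, plus the vector
  \<open>[\<alpha>, \<beta>, 0]\<close>, which the system annihilates. The normalisation is assumed
  at all points because it gets differentiated.\<close>

lemma normalized_cross3_eq_0:
  fixes u v w :: "real \<times> real \<Rightarrow> real"
  defines "N \<equiv> \<lambda>p. w p *\<^sub>R (vector [u p, v p, 1] :: real ^ 3)"
  assumes u: "pser c r u" and v: "pser d r v" and w: "pser e r w" and p: "p \<in> {-r<..<r} \<times> {-r<..<r}"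
    and norm: "\<And>p. w p * w p * (1 + (u p * u p + v p * v p)) = 1"
    and pde_u: "pdy (pdx u) p * (1 + (u p)\<^sup>2 + (v p)\<^sup>2) =
      2 * u p * pdx u p * pdy u p + v p * (pdx u p * pdy v p + pdy u p * pdx v p)"
    and pde_v: "pdy (pdx v) p * (1 + (v p)\<^sup>2 + (u p)\<^sup>2) =
      2 * v p * pdx v p * pdy v p + u p * (pdx v p * pdy u p + pdy v p * pdx u p)"
  shows "\<exists>e. pser e r N" and "cross3 (N p) (pdy (pdx N) p) = 0"
proof -
  have N_eq: "N = (\<lambda>p. (w p * u p) *\<^sub>R axis 1 1 + (w p * v p) *\<^sub>R axis 2 1 + w p *\<^sub>R axis 3 1)"
    by (auto simp: N_def fun_eq_iff vec_eq_iff forall_3 axis_def)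
  note lin = pser_bounded_linear[OF _ bounded_linear_scaleR_left]
  show "\<exists>e. pser e r N"
    unfolding N_eq by (intro exI, rule pser_add[OF pser_add]; rule lin; (rule pser_mult)?; rule u v w)
  then obtain C where N: "pser C r N" ..
  have pxy: "\<bar>fst p\<bar> < r" "\<bar>snd p\<bar> < r"
    using p by (cases p; auto)+
  \<comment> \<open>Both sides are series with the same coefficients, because taking a component is
    linear.\<close>
  have comp: "pdy (pdx N) p $ k = pdy (pdx (\<lambda>p. N p $ k)) p" for k
    using pser_unique[OF pser_bounded_linear[OF pser_pdy[OF pser_pdx[OF N]] bounded_linear_vec_nth[of k]] _ pxy]
      pser_pdy[OF pser_pdx[OF pser_bounded_linear[OF N bounded_linear_vec_nth[of k]]]]
    by (simp add: mult.assoc)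
  have N_nth: "(\<lambda>p. N p $ 1) = (\<lambda>p. w p * u p)" "(\<lambda>p. N p $ 2) = (\<lambda>p. w p * v p)" "(\<lambda>p. N p $ 3) = w"
    by (auto simp: N_def)
  note N_xy = comp[of 1, unfolded N_nth pdy_pdx_mult[OF w u p]]
    comp[of 2, unfolded N_nth pdy_pdx_mult[OF w v p]] comp[of 3, unfolded N_nth]
  have diff: "h differentiable (at p)" if "pser e r h" for e and h :: "real \<times> real \<Rightarrow> real"
    using pser_differentiable[OF that, of "fst p" "snd p"] pxy by simp
  note psers = u v w pser_mult pser_add pser_const[OF pser_pos[OF u], of "1 :: real"]
  have pd_1: "pdx (\<lambda>_. 1 :: real) p = 0" "pdy (\<lambda>_. 1 :: real) p = 0"
    by (simp_all add: pdx_def pdy_def)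
  define S where "S = 1 + (u p * u p + v p * v p)"
  have norm_p: "w p * w p * S = 1"
    using norm[of p] by (simp add: S_def)
  then have w_nz: "w p \<noteq> 0" by auto
  \<comment> \<open>Differentiating the constant \<open>1\<close> expresses the derivatives of
    \<open>w\<close> through those of \<open>u\<close> and \<open>v\<close>, without differentiating
    \<open>powr\<close>.\<close>
  have "pdx (\<lambda>p. w p * w p * (1 + (u p * u p + v p * v p))) p = 0"
      "pdy (\<lambda>p. w p * w p * (1 + (u p * u p + v p * v p))) p = 0"
    unfolding norm by (fact pd_1)+
  moreover have "pdx (\<lambda>p. w p * w p * (1 + (u p * u p + v p * v p))) p =
      w p * w p * (0 + (u p * pdx u p + pdx u p * u p + (v p * pdx v p + pdx v p * v p)))
      + (w p * pdx w p + pdx w p * w p) * S"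
    unfolding S_def
    by (subst pdx_mult pdx_add, (rule diff, (rule psers)+)+)+ (simp add: pd_1)
  moreover have "pdy (\<lambda>p. w p * w p * (1 + (u p * u p + v p * v p))) p =
      w p * w p * (0 + (u p * pdy u p + pdy u p * u p + (v p * pdy v p + pdy v p * v p)))
      + (w p * pdy w p + pdy w p * w p) * S"
    unfolding S_def
    by (subst pdy_mult pdy_add, (rule diff, (rule psers)+)+)+ (simp add: pd_1)
  ultimately have "w p * (w p * (u p * pdx u p + v p * pdx v p) + pdx w p * S) = 0"
      "w p * (w p * (u p * pdy u p + v p * pdy v p) + pdy w p * S) = 0"
    by (simp_all add: algebra_simps)
  then have w_x: "pdx w p * S = - w p * (u p * pdx u p + v p * pdx v p)"
    and w_y: "pdy w p * S = - w p * (u p * pdy u p + v p * pdy v p)"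
    using w_nz by (simp_all add: add_eq_0_iff)
  define \<alpha> where "\<alpha> = pdx w p * pdy u p + pdy w p * pdx u p + w p * pdy (pdx u) p"
  define \<beta> where "\<beta> = pdx w p * pdy v p + pdy w p * pdx v p + w p * pdy (pdx v) p"
  have S_nz: "S \<noteq> 0" using norm_p by auto
  \<comment> \<open>The factor \<open>S\<close> allows \<open>w_x\<close> and \<open>w_y\<close> to
    be substituted; what remains is \<open>w p\<close> times the difference of the two sides of the
    equation for \<open>u\<close>.\<close>
  have "\<alpha> * S = (pdx w p * S) * pdy u p + (pdy w p * S) * pdx u p + w p * (pdy (pdx u) p * (1 + (u p)\<^sup>2 + (v p)\<^sup>2))"
    by (simp add: \<alpha>_def S_def algebra_simps power2_eq_square)
  also have "\<dots> = 0"
    unfolding w_x w_y pde_u by (simp add: algebra_simps)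
  finally have \<alpha>: "\<alpha> = 0" using S_nz by simp
  have "\<beta> * S = (pdx w p * S) * pdy v p + (pdy w p * S) * pdx v p + w p * (pdy (pdx v) p * (1 + (v p)\<^sup>2 + (u p)\<^sup>2))"
    by (simp add: \<beta>_def S_def algebra_simps power2_eq_square)
  also have "\<dots> = 0"
    unfolding w_x w_y pde_v by (simp add: algebra_simps)
  finally have \<beta>: "\<beta> = 0" using S_nz by simp
  have "pdy (pdx N) p $ 1 = pdy (pdx w) p * u p + \<alpha>" "pdy (pdx N) p $ 2 = pdy (pdx w) p * v p + \<beta>"
      "pdy (pdx N) p $ 3 = pdy (pdx w) p"
    unfolding N_xy by (simp_all add: \<alpha>_def \<beta>_def)
  with \<alpha> \<beta> show "cross3 (N p) (pdy (pdx N) p) = 0"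
    by (simp add: cross3_def vec_eq_iff forall_3 N_def)
qed

section \<open>Taylor polynomials of the forced series\<close>

text \<open>This makes the prolongation by zero harmless: a polynomial of level \<open>L\<close>
  does not see the entries beyond \<open>L\<close>.\<close>

lemma jet_polys_cong:
  assumes "f \<in> jet_polys L"
    and "\<And>l. 1 \<le> l \<Longrightarrow> l \<le> L \<Longrightarrow> a l 0 = a' l 0 \<and> a l l = a' l l \<and> b l 0 = b' l 0 \<and> b l l = b' l l"
  shows "f a b = f a' b'"
  using assms by (induction rule: jet_polys.induct) auto

lemma jet_sum_eq:
  fixes c :: "nat \<Rightarrow> nat \<Rightarrow> real"
  assumes "c 0 0 = 0" "c 1 1 = 0"
  shows "(\<Sum>k=0..n. \<Sum>i=0..k. c (k - i) i * x ^ (k - i) * y ^ i) =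
    (\<Sum>k=1..n. c k 0 * x ^ k) + (\<Sum>k=1..n. c 0 k * y ^ k)
    + (\<Sum>k=3..n. \<Sum>i=1..k-1. c (k - i) i * x ^ (k - i) * y ^ i)"
proof -
  let ?t = "\<lambda>k i. c (k - i) i * x ^ (k - i) * y ^ i"
  \<comment> \<open>For \<open>k = 0\<close> the two axis terms would be the same term counted
    twice.\<close>
  have split: "(\<Sum>i=0..k. ?t k i) = c k 0 * x ^ k + c 0 k * y ^ k + (\<Sum>i=1..k-1. ?t k i)" if "k \<ge> 1" for k
  proof -
    have "{0..k} = insert 0 (insert k {1..k-1})"
      using that by auto
    then show ?thesis
      using that by (simp add: add.assoc)
  qed
  have "(\<Sum>k=0..n. \<Sum>i=0..k. ?t k i) = (\<Sum>k=1..n. \<Sum>i=0..k. ?t k i)"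
    using assms(1) by (simp add: sum.atLeast_Suc_atMost)
  also have "\<dots> = (\<Sum>k=1..n. c k 0 * x ^ k + c 0 k * y ^ k + (\<Sum>i=1..k-1. ?t k i))"
    by (intro sum.cong split) auto
  also have "\<dots> = (\<Sum>k=1..n. c k 0 * x ^ k) + (\<Sum>k=1..n. c 0 k * y ^ k) + (\<Sum>k=1..n. \<Sum>i=1..k-1. ?t k i)"
    by (simp add: sum.distrib)
  also have "(\<Sum>k=1..n. \<Sum>i=1..k-1. ?t k i) = (\<Sum>k=3..n. \<Sum>i=1..k-1. ?t k i)"
  proof (rule sum.mono_neutral_right)
    show "\<forall>k\<in>{1..n} - {3..n}. (\<Sum>i=1..k-1. ?t k i) = 0"
    proof
      fix k assume "k \<in> {1..n} - {3..n}"
      \<comment> \<open>Degree 1 has no mixed term, and the only one of degree 2 is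
        \<open>c 1 1\<close>.\<close>
      then have "k = 1 \<or> k = 2" by auto
      then show "(\<Sum>i=1..k-1. ?t k i) = 0" using assms(2) by auto
    qed
  qed auto
  finally show ?thesis .
qed

lemma jet_forced_coef:
  assumes u: "pser (forced_coef A B) r u"
    and eq: "\<And>l. 1 \<le> l \<Longrightarrow> l \<le> n \<Longrightarrow> A l 0 = a l 0 \<and> A l l = a l l \<and> B l 0 = b l 0 \<and> B l l = b l l"
  shows "jet n u x y = (\<Sum>k=1..n. a k 0 * x ^ k) + (\<Sum>k=1..n. a k k * y ^ k)
    + (\<Sum>k=3..n. \<Sum>i=1..k-1. P_poly k i a b * x ^ (k - i) * y ^ i)"
proof -
  have "P_poly k i A B = P_poly k i a b" if "3 \<le> k" "k \<le> n" "1 \<le> i" "i \<le> k - 1" for k i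
    by (rule jet_polys_cong[OF P_universal_polynomial]) (use that eq in auto)
  then have "(\<Sum>k=3..n. \<Sum>i=1..k-1. forced_coef A B (k - i) i * x ^ (k - i) * y ^ i) =
      (\<Sum>k=3..n. \<Sum>i=1..k-1. P_poly k i a b * x ^ (k - i) * y ^ i)"
    by (intro sum.cong) (auto simp: P_poly_def)
  moreover have "(\<Sum>k=1..n. forced_coef A B k 0 * x ^ k) = (\<Sum>k=1..n. a k 0 * x ^ k)"
      "(\<Sum>k=1..n. forced_coef A B 0 k * y ^ k) = (\<Sum>k=1..n. a k k * y ^ k)"
    by (intro sum.cong; simp add: forced_coef_axes eq)+
  moreover have "forced_coef A B 1 1 = 0"
    using P_2_1[of A B] by (simp add: P_poly_def numeral_2_eq_2)
  ultimately show ?thesis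
    unfolding pser_jet[OF u] by (subst jet_sum_eq) (simp_all add: forced_coef_axes)
qed

theorem theorem2p4:
  fixes n :: nat and a b :: "nat \<Rightarrow> nat \<Rightarrow> real"
  assumes "n \<ge> 1"
  shows "\<exists>(U :: (real \<times> real) set) (N :: real \<times> real \<Rightarrow> real ^ 3)
           (u :: real \<times> real \<Rightarrow> real) (v :: real \<times> real \<Rightarrow> real).
    open U \<and> (0, 0) \<in> U \<and>
    (\<forall>p\<in>U. N p = (1 + (u p)\<^sup>2 + (v p)\<^sup>2) powr (-1/2) *\<^sub>R vector [u p, v p, 1]) \<and>
    real_analytic_on U N \<and> lorentzian_harmonic_on U N \<and>
    u (0, 0) = 0 \<and> v (0, 0) = 0 \<and>
    (\<forall>x y. jet n u x y =
        (\<Sum>k=1..n. a k 0 * x ^ k) + (\<Sum>k=1..n. a k k * y ^ k)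
        + (\<Sum>k=3..n. \<Sum>i=1..k-1. P_poly k i a b * x ^ (k - i) * y ^ i)) \<and>
    (\<forall>x y. jet n v x y =
        (\<Sum>k=1..n. b k 0 * x ^ k) + (\<Sum>k=1..n. b k k * y ^ k)
        + (\<Sum>k=3..n. \<Sum>i=1..k-1. P_poly k i b a * x ^ (k - i) * y ^ i))"
proof -
  \<comment> \<open>The entries beyond \<open>n\<close> are arbitrary and could grow too fast for
    convergence.\<close>
  define A B where "A = (\<lambda>l m. if l \<le> n then a l m else 0)" and "B = (\<lambda>l m. if l \<le> n then b l m else 0)"
  obtain R u v where u: "pser (forced_coef A B) R u" and v: "pser (forced_coef B A) R v"
    by (rule forced_coef_pser[of n A B]) (auto simp: A_def B_def)
  define w where "w = (\<lambda>p. (1 + (u p * u p + v p * v p)) powr (-1/2))"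
  obtain d r where r: "0 < r" "r \<le> R" and w: "pser d r w"
    unfolding w_def
  \<comment> \<open>The binomial series with exponent \<open>-1/2\<close> has radius
    \<open>1\<close>; the inner series \<open>u p * u p + v p * v p\<close> starts without constant
    term.\<close>
  proof (rule pser_compose[OF pser_add[OF pser_mult[OF u u] pser_mult[OF v v]] _ zero_less_one
        gen_binomial_real[of _ "-1/2"]])
    show "conv (forced_coef A B) (forced_coef A B) 0 0 + conv (forced_coef B A) (forced_coef B A) 0 0 = 0"
      by (simp add: conv_def forced_coef_axes)
  qed
  note u' = pser_mono[OF u r] and v' = pser_mono[OF v r]
  define U where "U = {-r<..<r} \<times> {-r<..<r}"
  define N where "N = (\<lambda>p. w p *\<^sub>R (vector [u p, v p, 1] :: real ^ 3))"
  \<comment> \<open>Positivity also holds outside the square, where \<open>u\<close> and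
    \<open>v\<close> are unconstrained; hence the normalisation is an identity of functions.\<close>
  have pos: "1 + (u p * u p + v p * v p) > 0" for p
    by (simp add: add_pos_nonneg)
  have norm: "w p * w p * (1 + (u p * u p + v p * v p)) = 1" for p
  proof -
    have "w p * w p = 1 / (1 + (u p * u p + v p * v p))"
      unfolding w_def powr_add[symmetric] using pos[of p] by (simp add: powr_minus_divide)
    then show ?thesis using pos[of p] by simp
  qed
  \<comment> \<open>Both facts come from one lemma formulated at a point; the expansion of
    \<open>N\<close> is afterwards extracted at the origin.\<close>
  have cross: "(\<exists>e. pser e r N) \<and> cross3 (N p) (pdy (pdx N) p) = 0" if "p \<in> U" for p
  proof -
    have p: "p \<in> {-r<..<r} \<times> {-r<..<r}" "\<bar>fst p\<bar> < r" "\<bar>snd p\<bar> < r"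
      using that by (auto simp: U_def mem_Times_iff)
    note forced_coef_pde[OF u' v' p(2,3), unfolded prod.collapse]
      forced_coef_pde[OF v' u' p(2,3), unfolded prod.collapse]
    from normalized_cross3_eq_0[OF u' v' w p(1) norm this] show ?thesis
      by (simp add: N_def)
  qed
  have "(0, 0) \<in> U" "open U"
    using r by (auto simp: U_def open_Times)
  with cross obtain e where N: "pser e r N" by blast
  have "norm (N p) = 1" for p
  proof -
    have "(norm (N p))\<^sup>2 = w p * w p * (1 + (u p * u p + v p * v p))"
      unfolding power2_norm_eq_inner by (simp add: N_def inner_vec_def sum_3 algebra_simps)
    then show ?thesis
      using norm_ge_zero[of "N p"] unfolding norm power2_eq_1_iff by linarith
  qed
  then have "lorentzian_harmonic_on U N"
    unfolding lorentzian_harmonic_on_def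
    using cross3_harmonic_null_coordinates[OF N cross[THEN conjunct2, unfolded U_def]] pser_smooth_on[OF N]
      \<open>open U\<close> by (auto simp: U_def)
  moreover have "real_analytic_on U N"
    unfolding U_def by (rule pser_imp_real_analytic_on[OF N])
  moreover have "u (0, 0) = 0" "v (0, 0) = 0"
    unfolding pser_at_0[OF u] pser_at_0[OF v] by (simp_all add: forced_coef_axes)
  moreover have "N p = (1 + (u p)\<^sup>2 + (v p)\<^sup>2) powr (-1/2) *\<^sub>R vector [u p, v p, 1]" for p
    by (simp add: N_def w_def power2_eq_square add.assoc)
  moreover note \<open>open U\<close> \<open>(0, 0) \<in> U\<close>
    jet_forced_coef[OF u, of n a b] jet_forced_coef[OF v, of n b a]
  ultimately show ?thesis
    by (intro exI[of _ U] exI[of _ N] exI[of _ u] exI[of _ v]) (simp add: A_def B_def)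
qed

end
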